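(* Let $\mu\preceq_{\mathrm{st}}\nu$ be Borel probability measures on $\mathbb{R}$. For a coupling $P\in\mathcal{D}(\mu,\nu)$, the following are equivalent. (i) $F_P\le F_Q$ on $\mathbb{R}^2$ for all $Q\in\mathcal{D}(\mu,\nu)$, where $F_Q(x,y)=Q((-\infty,x]\times(-\infty,y])$ is the cdf of $Q$. (ii) $P$ is optimal for all $(\mu,\nu)$-integrable and submodular $g$. (iii) $P$ is optimal for some $(\mu,\nu)$-integrable and strictly submodular $g$. (iv) $P$ is supported by a set $\Gamma\subseteq\mathbb{H}$ with the constrained crossing property. (v) $P=P_*(\mu,\nu)$.
   Context: For finite Borel measures $\theta_1,\theta_2$ on $\mathbb{R}$ with cdf's $F_{\theta_i}(t)=\theta_i((-\infty,t])$, $\theta_1\preceq_{\mathrm{st}}\theta_2$ means $\theta_1(\mathbb{R})=\theta_2(\mathbb{R})$ and $F_{\theta_1}\ge F_{\theta_2}$; $\theta_1\le\theta_2$ means $\theta_1(A)\le\theta_2(A)$ for all Borel $A$. $\mathbb{H}=\{(x,y)\in\mathbb{R}^2:y\ge x\}$. $\mathcal{D}(\mu,\nu)$ is the set of directional couplings: probability measures on $\mathbb{R}^2$ with first marginal $\mu$ and second marginal $\nu$ that are concentrated on $\mathbb{H}$. $P_*(\mu,\nu)$ denotes the optimal directional coupling: the unique $P\in\mathcal{D}(\mu,\nu)$ such that $P((x,\infty)\times\cdot)=\nu_x$ for all $x\in\mathbb{R}$, where $\nu_x$ is the unique minimal element for $\preceq_{\mathrm{st}}$ of $\{\theta:\mu|_{(x,\infty)}\preceq_{\mathrm{st}}\theta\le\nu\}$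 (equivalently, $F_{\nu_x}$ is the supremum of $F_\theta$ over this set). Existence and uniqueness hold whenever $\mu\preceq_{\mathrm{st}}\nu$. A pair $((x,y),(x',y'))\in\mathbb{H}^2$ is improvable if $x<x'\le y<y'$. A set $\Gamma\subseteq\mathbb{H}$ has the constrained crossing property if it contains no improvable pairs. $P$ is supported by a (Borel) set $\Gamma$ if $P(\Gamma)=1$. A Borel function $g:\mathbb{H}\to\mathbb{R}$ is submodular if $g(x,y)+g(x',y')\le g(x,y')+g(x',y)$ for all $x<x'\le y<y'$, and strictly submodular if this inequality is always strict. It is $(\mu,\nu)$-integrable if $|g(x,y)|\le\phi(x)+\psi(y)$ for some $\phi\in L^1(\mu)$, $\psi\in L^1(\nu)$. $P\in\mathcal{D}(\mu,\nu)$ is optimal for $g$ if it attains $\sup_{Q\in\mathcal{D}(\mu,\nu)}\int g\,dQ$. *)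

theory Defs
  imports "HOL-Probability.Probability"
begin

definition st_le :: "real measure \<Rightarrow> real measure \<Rightarrow> bool" (infix "\<preceq>\<^sub>s\<^sub>t" 50) where
  "\<theta>\<^sub>1 \<preceq>\<^sub>s\<^sub>t \<theta>\<^sub>2 \<longleftrightarrow> measure \<theta>\<^sub>1 UNIV = measure \<theta>\<^sub>2 UNIV \<and> (\<forall>t. cdf \<theta>\<^sub>1 t \<ge> cdf \<theta>\<^sub>2 t)"

definition halfplane :: "(real \<times> real) set" where
  "halfplane = {(x, y). x \<le> y}"

definition directional_couplings :: "real measure \<Rightarrow> real measure \<Rightarrow> (real \<times> real) measure set" where
  "directional_couplings \<mu> \<nu> =
     {P. prob_space P \<and> sets P = sets borel \<and>
         distr P borel fst = \<mu> \<and> distr P borel snd = \<nu> \<and> measure P halfplane = 1}"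

definition cdf2 :: "(real \<times> real) measure \<Rightarrow> real \<Rightarrow> real \<Rightarrow> real" where
  "cdf2 Q x y = measure Q ({..x} \<times> {..y})"


text \<open>The density with respect to \<^term>\<open>\<mu>\<close> is the restriction of \<^term>\<open>\<mu>\<close> to \<open>(x, \<infinity>)\<close>, viewed as a
  measure on the whole line (unlike \<^const>\<open>restrict_space\<close>, which shrinks the space). On measures
  with the same \<open>\<sigma>\<close>-algebra, the library order \<open>\<le>\<close> is setwise domination.\<close>

definition target_candidates :: "real measure \<Rightarrow> real measure \<Rightarrow> real \<Rightarrow> real measure set" where
  "target_candidates \<mu> \<nu> x =
     {\<theta>. finite_borel_measure \<theta> \<and> density \<mu> (indicator {x<..}) \<preceq>\<^sub>s\<^sub>t \<theta> \<and> \<theta> \<le> \<nu>}"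

definition minimal_target :: "real measure \<Rightarrow> real measure \<Rightarrow> real \<Rightarrow> real measure" where
  "minimal_target \<mu> \<nu> x =
     (THE \<theta>. \<theta> \<in> target_candidates \<mu> \<nu> x \<and>
             (\<forall>\<theta>' \<in> target_candidates \<mu> \<nu> x. \<theta>' \<preceq>\<^sub>s\<^sub>t \<theta> \<longrightarrow> \<theta>' = \<theta>))"

definition optimal_directional_coupling :: "real measure \<Rightarrow> real measure \<Rightarrow> (real \<times> real) measure" where
  "optimal_directional_coupling \<mu> \<nu> =
     (THE P. P \<in> directional_couplings \<mu> \<nu> \<and>
             (\<forall>x. \<forall>A \<in> sets borel. emeasure P ({x<..} \<times> A) = emeasure (minimal_target \<mu> \<nu> x) A))"


definition improvable :: "real \<times> real \<Rightarrow> real \<times> real \<Rightarrow> bool" where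
  "improvable p p' \<longleftrightarrow> p \<in> halfplane \<and> p' \<in> halfplane \<and>
     fst p < fst p' \<and> fst p' \<le> snd p \<and> snd p < snd p'"

definition constrained_crossing :: "(real \<times> real) set \<Rightarrow> bool" where
  "constrained_crossing \<Gamma> \<longleftrightarrow> (\<forall>p \<in> \<Gamma>. \<forall>p' \<in> \<Gamma>. \<not> improvable p p')"

definition supported_by :: "(real \<times> real) measure \<Rightarrow> (real \<times> real) set \<Rightarrow> bool" where
  "supported_by P \<Gamma> \<longleftrightarrow> \<Gamma> \<in> sets borel \<and> measure P \<Gamma> = 1"


text \<open>Reward functions are functions on \<^const>\<open>halfplane\<close>: every condition on them, and the integral
  defining optimality, ignores the values of the underlying total function outside
  \<^const>\<open>halfplane\<close>.\<close>

definition submodular :: "(real \<times> real \<Rightarrow> real) \<Rightarrow> bool" where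
  "submodular g \<longleftrightarrow> g \<in> borel_measurable (restrict_space borel halfplane) \<and>
     (\<forall>x x' y y'. x < x' \<and> x' \<le> y \<and> y < y' \<longrightarrow> g (x, y) + g (x', y') \<le> g (x, y') + g (x', y))"

definition strictly_submodular :: "(real \<times> real \<Rightarrow> real) \<Rightarrow> bool" where
  "strictly_submodular g \<longleftrightarrow> g \<in> borel_measurable (restrict_space borel halfplane) \<and>
     (\<forall>x x' y y'. x < x' \<and> x' \<le> y \<and> y < y' \<longrightarrow> g (x, y) + g (x', y') < g (x, y') + g (x', y))"

definition marginal_integrable :: "real measure \<Rightarrow> real measure \<Rightarrow> (real \<times> real \<Rightarrow> real) \<Rightarrow> bool" where
  "marginal_integrable \<mu> \<nu> g \<longleftrightarrow>
     (\<exists>\<phi> \<psi>. integrable \<mu> \<phi> \<and> integrable \<nu> \<psi> \<and> (\<forall>(x, y) \<in> halfplane. \<bar>g (x, y)\<bar> \<le> \<phi> x + \<psi> y))"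

text \<open>The supremum is taken in \<^typ>\<open>ereal\<close>, since \<^const>\<open>Sup\<close> on \<^typ>\<open>real\<close> is
  unspecified for unbounded sets.\<close>

definition optimal_for ::
    "real measure \<Rightarrow> real measure \<Rightarrow> (real \<times> real \<Rightarrow> real) \<Rightarrow> (real \<times> real) measure \<Rightarrow> bool" where
  "optimal_for \<mu> \<nu> g P \<longleftrightarrow> P \<in> directional_couplings \<mu> \<nu> \<and>
     ereal (LINT p:halfplane|P. g p) = (SUP Q \<in> directional_couplings \<mu> \<nu>. ereal (LINT p:halfplane|Q. g p))"

end

theory Submission
  imports Defs
begin

text \<open>
  Write \<open>H = F\<^sub>\<mu> - F\<^sub>\<nu>\<close>. A directional coupling gives mass \<open>H z\<close> to \<open>{..z} \<times> {z<..}\<close>, so for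
  \<open>x \<le> y\<close> the mass of \<open>{..x} \<times> {y<..}\<close> is at most the infimum of \<open>H\<close> over \<open>[x, y]\<close>. This is a pointwise
  lower bound for all cdfs. If improvable pairs are negligible, a point of the support with
  \<open>X \<le> x\<close> and maximal \<open>Y \<le> y\<close> shows that the bound is attained; conversely, where the infimum of \<open>H\<close> is
  (nearly) attained two rectangles are null, and removing them for all rational \<open>x \<le> y\<close> leaves a set
  without improvable pairs. The bound itself is the cdf of a coupling, which comes from a family of
  measures dominated by \<open>\<nu>\<close> through conditional quantiles, and its slices are the minimal targets.

  A set without improvable pairs is cyclically monotone for every submodular reward. To pass from
  finite cycles to the coupling \<open>P\<close> and a competitor \<open>Q\<close>, run the stationary Markov chain
  \<open>X\<^sub>0, Y\<^sub>0, X\<^sub>1, Y\<^sub>1, \<dots>\<close> with \<open>(X\<^sub>i, Y\<^sub>i) \<sim> P\<close> and \<open>(X\<^bsub>i+1\<^esub>, Y\<^sub>i) \<sim> Q\<close>. Almost surely \<open>Y\<^sub>j \<ge> Y\<^sub>0 \<ge> X\<^sub>0\<close> for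
  infinitely many \<open>j\<close>, at which the cycle can be closed inside the half-plane at bounded cost, and the
  maximal ergodic lemma yields \<open>\<integral> g dQ \<le> \<integral> g dP\<close>. Optimality for one strictly submodular reward forces
  improvable pairs to be negligible, since exchanging them strictly increases the reward.
\<close>

text \<open>Optimality of a cyclically monotone coupling is usually read off dual potentials. Here
  the reward is merely Borel and is constrained only on \<open>halfplane\<close>, so two points need
  not be joined by an admissible chain, and potentials are neither obviously finite nor obviously
  integrable. The stationary chain avoids them: the difference of the two rewards becomes a sum
  along an orbit, where finite cycles suffice.

  Since \<open>optimal_directional_coupling\<close> and \<open>minimal_target\<close> are definite
  descriptions, nothing can be drawn from (v) before a coupling with the required slices has been
  produced. Every other condition is therefore compared with one fixed coupling, known only through
  its cdf \<open>least_cdf\<close>.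

  Writing conditional laws as functions of a uniform variable serves twice: it produces this
  coupling from its cdf, and it turns two alternating kernels into a shift driven by i.i.d.
  noise.\<close>

section \<open>Cyclic monotonicity and stationary transformations\<close>

text \<open>Remove the pair with maximal \<open>x\<close>, and minimal \<open>y\<close> among those: without improvable pairs, matching it
  back to its own partner does not decrease the sum.\<close>

lemma noncrossing_sum_le:
  fixes x y :: "'i \<Rightarrow> real"
  assumes "finite S" "bij_betw \<sigma> S S" "\<And>i. i \<in> S \<Longrightarrow> (x i, y i) \<in> \<Gamma>"
    and "\<And>i. i \<in> S \<Longrightarrow> x (\<sigma> i) \<le> y i"
    and \<Gamma>: "\<Gamma> \<subseteq> halfplane" "constrained_crossing \<Gamma>"
    and g: "\<And>x x' y y'. x < x' \<Longrightarrow> x' \<le> y \<Longrightarrow> y < y' \<Longrightarrow> g (x, y) + g (x', y') \<le> g (x, y') + g (x', y)"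
  shows "(\<Sum>i\<in>S. g (x (\<sigma> i), y i)) \<le> (\<Sum>i\<in>S. g (x i, y i) :: real)"
  using assms(1-4)
proof (induction "card S" arbitrary: S \<sigma>)
  case 0
  then show ?case by simp
next
  case (Suc n)
  note fin = \<open>finite S\<close> and bij = \<open>bij_betw \<sigma> S S\<close>
  from Suc have ne: "S \<noteq> {}" by auto
  define S' where "S' = {i\<in>S. x i = Max (x ` S)}"
  have "Max (x ` S) \<in> x ` S" using ne fin by (intro Max_in) auto
  then have S': "S' \<noteq> {}" "finite S'" using fin unfolding S'_def by force+
  then have "Min (y ` S') \<in> y ` S'" by (intro Min_in) auto
  then obtain a where a: "a \<in> S'" "y a = Min (y ` S')" by force
  have aS: "a \<in> S" and amax: "\<And>i. i \<in> S \<Longrightarrow> x i \<le> x a"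
    using a fin by (auto simp: S'_def)
  have amin: "y a \<le> y i" if "i \<in> S" "x i = x a" for i
    using a that S' by (auto simp: S'_def)
  obtain b where b: "b \<in> S" "\<sigma> b = a"
    using bij aS by (metis bij_betw_iff_bijections)
  define c where "c = \<sigma> a"
  have cS: "c \<in> S" using bij aS unfolding c_def by (meson bij_betwE)
  \<comment> \<open>\<open>b\<close> is the index whose \<open>y\<close> is matched with
    \<open>x a\<close>, so \<open>x a \<le> y b\<close>. If \<open>x b < x a\<close>, then
    \<open>y b < y a\<close> would make the pair of \<open>b\<close> and \<open>a\<close>
    improvable. The tie \<open>x b = x a\<close> is the reason for choosing \<open>y a\<close>
    minimal.\<close>
  have crossing: "y a \<le> y b"
  proof (cases "x b = x a")
    case True
    then show ?thesis using amin b by auto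
  next
    case False
    then have "x b < x a" using amax b by force
    moreover have "x a \<le> y b" using Suc.prems(4)[OF b(1)] b by simp
    moreover have "\<not> improvable (x b, y b) (x a, y a)"
      using \<Gamma>(2) Suc.prems(3) b aS by (auto simp: constrained_crossing_def)
    moreover have "(x b, y b) \<in> halfplane" "(x a, y a) \<in> halfplane"
      using \<Gamma>(1) Suc.prems(3) b aS by auto
    ultimately show ?thesis by (auto simp: improvable_def)
  qed
  have xya: "x a \<le> y a" using \<Gamma>(1) Suc.prems(3)[OF aS] by (auto simp: halfplane_def)
  have xca: "x c \<le> x a" "x c \<le> y a"
    using amax cS Suc.prems(4)[OF aS] unfolding c_def by auto
  have swap: "g (x c, y a) + g (x a, y b) \<le> g (x c, y b) + g (x a, y a)"
    using g[of "x c" "x a" "y a" "y b"] xya xca crossing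
    by (cases "x c = x a"; cases "y a = y b") auto
  \<comment> \<open>\<open>a\<close> is spliced out of the permutation: \<open>y a\<close> returns
    to \<open>x a\<close>, and \<open>y b\<close> takes over \<open>x c\<close>, the former partner
    of \<open>y a\<close>. For \<open>b = a\<close> nothing changes, since then
    \<open>c = a\<close>.\<close>
  define \<sigma>' where "\<sigma>' = \<sigma>(b := c)"
  have inj: "inj_on \<sigma> S" and img: "\<sigma> ` S = S" using bij by (auto simp: bij_betw_def)
  have bij': "bij_betw \<sigma>' (S - {a}) (S - {a})"
  proof (rule bij_betw_imageI)
    show inj': "inj_on \<sigma>' (S - {a})"
      using inj aS b by (auto simp: inj_on_def \<sigma>'_def c_def)
    have "\<sigma>' ` (S - {a}) \<subseteq> S - {a}"
      using inj img aS b unfolding \<sigma>'_def c_def inj_on_def by auto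
    then show "\<sigma>' ` (S - {a}) = S - {a}"
      using inj' fin by (intro endo_inj_surj) auto
  qed
  have IH: "(\<Sum>i\<in>S - {a}. g (x (\<sigma>' i), y i)) \<le> (\<Sum>i\<in>S - {a}. g (x i, y i))"
  proof (rule Suc.hyps(1)[OF _ _ bij'])
    show "n = card (S - {a})" using Suc.hyps(2) aS by simp
    fix i assume "i \<in> S - {a}"
    then show "x (\<sigma>' i) \<le> y i"
      using Suc.prems(4)[of i] xca crossing by (auto simp: \<sigma>'_def)
  qed (use fin Suc.prems(3) in auto)
  have "(\<Sum>i\<in>S. g (x (\<sigma> i), y i)) \<le> g (x a, y a) + (\<Sum>i\<in>S - {a}. g (x (\<sigma>' i), y i))"
  proof (cases "b = a")
    case True
    then have "\<sigma>' = \<sigma>" using b by (auto simp: \<sigma>'_def c_def)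
    then show ?thesis using True b by (simp add: sum.remove[OF fin aS])
  next
    case False
    have "(\<Sum>i\<in>S. g (x (\<sigma> i), y i)) = g (x c, y a) + (g (x a, y b) + (\<Sum>i\<in>S - {a} - {b}. g (x (\<sigma> i), y i)))"
      using False b fin by (simp add: sum.remove[OF fin aS] sum.remove[of "S - {a}" b] c_def)
    also have "(\<Sum>i\<in>S - {a} - {b}. g (x (\<sigma> i), y i)) = (\<Sum>i\<in>S - {a} - {b}. g (x (\<sigma>' i), y i))"
      by (intro sum.cong) (auto simp: \<sigma>'_def)
    finally show ?thesis
      using False b fin swap by (simp add: sum.remove[of "S - {a}" b] \<sigma>'_def)
  qed
  then show ?case using IH by (simp add: sum.remove[OF fin aS])
qed

text \<open>Garsia's argument: where the maximum of the first \<open>n\<close> partial sums is positive, \<^term>\<open>D\<close> is at least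
  that maximum minus its image under the shift.\<close>

lemma maximal_ergodic:
  fixes D :: "'a \<Rightarrow> real"
  assumes T: "T \<in> measurable M M" "distr M M T = M"
    and D: "integrable M D"
    and pos: "AE w in M. \<exists>n. 0 < (\<Sum>i<n. D ((T ^^ i) w))"
  shows "0 \<le> (\<integral>w. D w \<partial>M)"
proof -
  define S where "S n w = (\<Sum>i<n. D ((T ^^ i) w))" for n w
  have S_Suc: "S (Suc n) w = D w + S n (T w)" for n w
    unfolding S_def by (simp only: sum.lessThan_Suc_shift) (simp add: funpow_Suc_right del: funpow.simps)
  \<comment> \<open>The empty sum \<open>k = 0\<close> takes part, so \<open>Mx\<close> is
    nonnegative; off the set \<open>B n\<close> below, where \<open>Mx\<close> vanishes, this makes
    its difference with the shifted maximum nonpositive.\<close>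
  define Mx where "Mx n w = Max ((\<lambda>k. S k w) ` {..n})" for n w
  have Mx_Suc: "Mx (Suc n) w = max (Mx n w) (S (Suc n) w)" for n w
    unfolding Mx_def by (simp add: atMost_Suc max.commute)
  have int_T: "integrable M (\<lambda>w. f (T w))" if "integrable M f" for f :: "'a \<Rightarrow> real"
    using that T by (metis integrable_distr)
  have eq_T: "(\<integral>w. f (T w) \<partial>M) = (\<integral>w. f w \<partial>M)" if "integrable M f" for f :: "'a \<Rightarrow> real"
    using integral_distr[OF T(1), of f] that T(2) by auto
  have S_int: "integrable M (S n)" for n
  proof (induction n)
    case 0
    then show ?case by (simp add: S_def)
  next
    case (Suc n)
    then show ?case using D int_T[OF Suc] by (simp add: S_Suc[abs_def])
  qed
  have Mx_int: "integrable M (Mx n)" for n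
  proof (induction n)
    case 0
    then show ?case by (simp add: Mx_def S_def)
  next
    case (Suc n)
    then show ?case using S_int[of "Suc n"] by (simp add: Mx_Suc[abs_def])
  qed
  have Mx_ge: "S k w \<le> Mx n w" if "k \<le> n" for k n w
    using that by (auto simp: Mx_def)
  have Mx_nonneg: "0 \<le> Mx n w" for n w
    using Mx_ge[of 0 n w] by (simp add: S_def)
  define B where "B n = {w\<in>space M. 0 < Mx n w}" for n
  have B_sets[measurable]: "B n \<in> sets M" for n
    using Mx_int[of n] unfolding B_def by (intro borel_measurable_less) auto
  have step: "0 \<le> (\<integral>w. indicator (B n) w * D w \<partial>M)" for n
  proof -
    have key: "Mx n w - Mx n (T w) \<le> indicator (B n) w * D w" if "w \<in> space M" for w
    proof (cases "0 < Mx n w")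
      case True
      have "Mx n w \<in> (\<lambda>k. S k w) ` {..n}" unfolding Mx_def by (intro Max_in) auto
      then obtain k where k: "k \<le> n" "Mx n w = S k w" by auto
      have "k \<noteq> 0"
      proof
        assume "k = 0"
        then show False using k(2) True by (simp add: S_def)
      qed
      then obtain j where j: "k = Suc j" by (cases k) auto
      have "Mx n w = D w + S j (T w)" using k j S_Suc by simp
      also have "\<dots> \<le> D w + Mx n (T w)" using Mx_ge[of j n "T w"] k j by simp
      finally show ?thesis using True that by (simp add: B_def)
    next
      case False
      then show ?thesis using Mx_nonneg[of n w] Mx_nonneg[of n "T w"] by (simp add: B_def)
    qed
    have "0 = (\<integral>w. Mx n w - Mx n (T w) \<partial>M)"
      using Mx_int[of n] int_T[OF Mx_int[of n]] eq_T[OF Mx_int[of n]] by simp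
    also have "\<dots> \<le> (\<integral>w. indicator (B n) w * D w \<partial>M)"
      using Mx_int[of n] int_T[OF Mx_int[of n]] D key
      by (intro integral_mono integrable_mult_indicator[of "B n" M D, simplified]) auto
    finally show ?thesis .
  qed
  have lim: "(\<lambda>n. \<integral>w. indicator (B n) w * D w \<partial>M) \<longlonglongrightarrow> (\<integral>w. D w \<partial>M)"
  proof (rule integral_dominated_convergence[where w="\<lambda>w. \<bar>D w\<bar>"])
    show "AE w in M. (\<lambda>n. indicator (B n) w * D w) \<longlonglongrightarrow> D w"
      using pos AE_space
    proof eventually_elim
      case (elim w)
      then obtain k where k: "0 < S k w" by (auto simp: S_def)
      have "eventually (\<lambda>n. indicator (B n) w * D w = D w) sequentially"
        using eventually_ge_at_top[of k]
      proof eventually_elim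
        case (elim n)
        then have "0 < Mx n w" using Mx_ge[of k n w] k by simp
        then show ?case using \<open>w \<in> space M\<close> by (simp add: B_def)
      qed
      then show ?case by (rule tendsto_eventually)
    qed
    show "AE w in M. norm (indicator (B n) w * D w) \<le> \<bar>D w\<bar>" for n
      by (auto simp: indicator_def)
  qed (use D in auto)
  show ?thesis using step by (intro LIMSEQ_le_const[OF lim]) auto
qed

lemma AE_funpow:
  assumes T: "T \<in> measurable M M" "distr M M T = M" and P: "AE w in M. P w"
  shows "AE w in M. \<forall>n. P ((T ^^ n) w)"
proof -
  have "AE w in M. P ((T ^^ n) w)" for n
  proof (induction n)
    case 0
    then show ?case using P by simp
  next
    case (Suc n)
    then have "AE w in distr M M T. P ((T ^^ n) w)" unfolding T(2) .
    from AE_distrD[OF T(1) this] show ?case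
      by (simp add: funpow_Suc_right del: funpow.simps)
  qed
  then show ?thesis by (simp add: AE_all_countable)
qed

text \<open>The events that the future stays strictly below the value at time \<open>n\<close> are equally likely for all
  \<open>n\<close> and disjoint up to null sets, hence null.\<close>

lemma stationary_recurrence:
  fixes Z :: "'a \<Rightarrow> real"
  assumes "finite_measure M"
    and T[measurable]: "T \<in> measurable M M" and Tdistr: "distr M M T = M"
    and Z[measurable]: "Z \<in> borel_measurable M"
  shows "AE w in M. \<forall>n. \<exists>j\<ge>n. Z w \<le> Z ((T ^^ j) w)"
proof -
  interpret finite_measure M by fact
  have Tn[measurable]: "(T ^^ n) \<in> measurable M M" for n
    by (induction n) (auto simp: id_def[symmetric])
  have Tn_space: "(T ^^ n) w \<in> space M" if "w \<in> space M" for n w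
    using measurable_space[OF Tn that] .
  have pre1: "measure M {w\<in>space M. P (T w)} = measure M {w\<in>space M. P w}"
    if [measurable]: "Measurable.pred M P" for P
  proof -
    have "measure M {w\<in>space M. P w} = measure (distr M M T) {w\<in>space M. P w}"
      using Tdistr by simp
    also have "\<dots> = measure M (T -` {w\<in>space M. P w} \<inter> space M)"
      by (subst measure_distr) auto
    also have "T -` {w\<in>space M. P w} \<inter> space M = {w\<in>space M. P (T w)}"
      using measurable_space[OF T] by auto
    finally show ?thesis ..
  qed
  note AE_Tn = AE_funpow[OF T Tdistr]
  define A where "A q w \<longleftrightarrow> (\<exists>j. q < Z ((T ^^ j) w))" for q w
  have A_meas[measurable]: "Measurable.pred M (A q)" for q
    unfolding A_def by measurable
  have A_T: "A q w" if "A q (T w)" for q w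
  proof -
    from that obtain j where "q < Z ((T ^^ j) (T w))" by (auto simp: A_def)
    then have "q < Z ((T ^^ Suc j) w)" by (simp add: funpow_Suc_right del: funpow.simps)
    then show ?thesis unfolding A_def by blast
  qed
  \<comment> \<open>The preimage of \<open>A q\<close> under \<open>T\<close> is contained in
    \<open>A q\<close> and has the same finite measure, so the two differ by a null set.\<close>
  have inv1: "AE w in M. A q w \<longrightarrow> A q (T w)" for q
  proof -
    have [measurable]: "Measurable.pred M (\<lambda>w. A q (T w))" by measurable
    have "measure M ({w\<in>space M. A q w} - {w\<in>space M. A q (T w)}) = 0"
      using pre1[OF A_meas[of q]] A_T by (subst finite_measure_Diff) auto
    then have "emeasure M ({w\<in>space M. A q w} - {w\<in>space M. A q (T w)}) = 0"
      by (simp add: emeasure_eq_measure)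
    then show ?thesis by (intro AE_I[where N="{w\<in>space M. A q w} - {w\<in>space M. A q (T w)}"]) auto
  qed
  then have "AE w in M. \<forall>q::rat. A (of_rat q) w \<longrightarrow> A (of_rat q) (T w)"
    by (simp add: AE_all_countable)
  from AE_Tn[OF this] have good: "AE w in M. \<forall>n. \<forall>q::rat. A (of_rat q) ((T ^^ n) w) \<longrightarrow> A (of_rat q) (T ((T ^^ n) w))" .
  define E where "E w \<longleftrightarrow> (\<forall>j\<ge>1. Z ((T ^^ j) w) < Z w)" for w
  have E_meas[measurable]: "Measurable.pred M E" unfolding E_def by measurable
  define G where "G w \<longleftrightarrow> (\<forall>n. \<forall>q::rat. A (of_rat q) ((T ^^ n) w) \<longrightarrow> A (of_rat q) (T ((T ^^ n) w)))" for w
  have [measurable]: "Measurable.pred M G"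
    unfolding G_def by measurable
  have A_all: "A (of_rat q) ((T ^^ n) w)" if "G w" "A (of_rat q) w" for n w and q :: rat
    by (induction n) (use that in \<open>auto simp: G_def\<close>)
  \<comment> \<open>A rational \<open>q\<close> between \<open>Z\<close> at time \<open>n\<close>
    and the larger \<open>Z\<close> at time \<open>m\<close> is exceeded at time \<open>m\<close>.
    By invariance it is exceeded again after time \<open>n\<close>, whereas \<open>E\<close> at time
    \<open>n\<close> keeps all later values below \<open>Z\<close> at time \<open>n\<close>.\<close>
  have disj: "\<not> (E ((T ^^ m) w) \<and> E ((T ^^ n) w))" if "G w" "m < n" for w m n
  proof
    assume E: "E ((T ^^ m) w) \<and> E ((T ^^ n) w)"
    have TT: "(T ^^ i) ((T ^^ k) w) = (T ^^ (i + k)) w" for i k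
      by (simp add: funpow_add)
    have "Z ((T ^^ n) w) < Z ((T ^^ m) w)"
      using E that(2) TT[of "n - m" m] unfolding E_def by (metis One_nat_def Suc_leI add.commute diff_add_inverse le_add_diff_inverse less_imp_le zero_less_diff)
    then obtain q where q: "Z ((T ^^ n) w) < of_rat q" "of_rat q < Z ((T ^^ m) w)"
      using of_rat_dense by blast
    have "A (of_rat q) w" using q(2) unfolding A_def by blast
    from A_all[OF that(1) this, of "Suc n"] obtain j where
      j: "of_rat q < Z ((T ^^ j) ((T ^^ Suc n) w))" unfolding A_def by blast
    have "(T ^^ j) ((T ^^ Suc n) w) = (T ^^ Suc j) ((T ^^ n) w)"
      unfolding TT by simp
    moreover have "Z ((T ^^ Suc j) ((T ^^ n) w)) < Z ((T ^^ n) w)"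
      using E unfolding E_def by (auto simp del: funpow.simps)
    ultimately show False using j q by simp
  qed
  define EE where "EE n = {w\<in>space M. G w \<and> E ((T ^^ n) w)}" for n
  have EEm: "EE n \<in> sets M" for n unfolding EE_def by measurable
  have E_eq: "measure M {w\<in>space M. E ((T ^^ n) w)} = measure M {w\<in>space M. E w}" for n
  proof (induction n)
    case (Suc n)
    have [measurable]: "Measurable.pred M (\<lambda>w. E ((T ^^ n) w))" by measurable
    show ?case using pre1[of "\<lambda>w. E ((T ^^ n) w)"] Suc by (simp add: funpow_Suc_right del: funpow.simps)
  qed simp
  have EE_eq: "measure M (EE n) = measure M {w\<in>space M. E w}" for n
  proof -
    have "measure M (EE n) = measure M {w\<in>space M. E ((T ^^ n) w)}"
      by (rule finite_measure_eq_AE) (use good in \<open>auto simp: EE_def G_def[symmetric]\<close>)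
    then show ?thesis using E_eq by simp
  qed
  have "disjoint_family EE"
    unfolding disjoint_family_on_def EE_def using disj by (auto simp: nat_neq_iff)
  then have "(\<lambda>n. measure M (EE n)) sums measure M (\<Union>n. EE n)"
    using EEm by (intro finite_measure_UNION) auto
  then have "summable (\<lambda>n::nat. measure M {w\<in>space M. E w})"
    unfolding EE_eq by (rule sums_summable)
  then have "measure M {w\<in>space M. E w} = 0" by (simp add: summable_const_iff)
  then have "AE w in M. \<not> E w"
    by (subst AE_iff_measurable[OF _ refl]) (auto simp: emeasure_eq_measure)
  from AE_Tn[OF this] show ?thesis
  proof eventually_elim
    case (elim w)
    have later: "\<exists>j>i. Z ((T ^^ i) w) \<le> Z ((T ^^ j) w)" for i
    proof -
      from elim obtain k where "k \<ge> 1" "Z ((T ^^ i) w) \<le> Z ((T ^^ k) ((T ^^ i) w))"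
        unfolding E_def by (auto simp: not_less)
      then show ?thesis by (intro exI[of _ "k + i"]) (auto simp: funpow_add)
    qed
    show ?case
    proof
      fix n show "\<exists>j\<ge>n. Z w \<le> Z ((T ^^ j) w)"
      proof (induction n)
        case 0
        show ?case by (intro exI[of _ 0]) auto
      next
        case (Suc n)
        then obtain j where "j \<ge> n" "Z w \<le> Z ((T ^^ j) w)" by blast
        with later[of j] show ?case by (meson Suc_leI le_less_trans order_trans)
      qed
    qed
  qed
qed

section \<open>Conditional quantiles\<close>

lemma sets_Collect_UNIV:
  assumes "space M = UNIV" "Measurable.pred M P"
  shows "{x. P x} \<in> sets M"
  using assms by (simp add: pred_def)

text \<open>On the set where \<open>g < f\<close> the integral of the positive difference is at most
  0; finiteness of the larger measure is what permits subtracting the integrals.\<close>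

lemma density_le_imp_AE_le:
  fixes f g :: "'a \<Rightarrow> ennreal"
  assumes [measurable]: "f \<in> borel_measurable M" "g \<in> borel_measurable M"
    and fin: "emeasure (density M g) (space M) \<noteq> \<infinity>"
    and le: "\<And>A. A \<in> sets M \<Longrightarrow> emeasure (density M f) A \<le> emeasure (density M g) A"
  shows "AE x in M. f x \<le> g x"
proof -
  define A where "A = {x\<in>space M. g x < f x}"
  have A[measurable]: "A \<in> sets M" unfolding A_def by measurable
  have f: "emeasure (density M f) A = (\<integral>\<^sup>+x. f x * indicator A x \<partial>M)"
    and g: "emeasure (density M g) A = (\<integral>\<^sup>+x. g x * indicator A x \<partial>M)"
    by (simp_all add: emeasure_density)
  have "emeasure (density M g) A \<le> emeasure (density M g) (space M)"
    using sets.sets_into_space[OF A] by (intro emeasure_mono) auto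
  then have gfin: "(\<integral>\<^sup>+x. g x * indicator A x \<partial>M) \<noteq> \<infinity>"
    using fin unfolding g by (auto simp: top_unique)
  have "(\<integral>\<^sup>+x. f x * indicator A x - g x * indicator A x \<partial>M)
      = (\<integral>\<^sup>+x. f x * indicator A x \<partial>M) - (\<integral>\<^sup>+x. g x * indicator A x \<partial>M)"
    using gfin by (intro nn_integral_diff) (auto simp: A_def indicator_def)
  also have "\<dots> = 0"
    using le[OF A] gfin unfolding f g by (auto simp: diff_eq_0_iff_ennreal less_top[symmetric] top_unique)
  finally have "AE x in M. f x * indicator A x - g x * indicator A x = 0"
    by (subst (asm) nn_integral_0_iff_AE) auto
  then show ?thesis
    using AE_space
  proof eventually_elim
    case (elim x)
    show ?case
    proof (rule ccontr)
      assume "\<not> f x \<le> g x"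
      then have "x \<in> A" using elim by (auto simp: A_def)
      then have "f x - g x = 0" using elim by simp
      then show False using \<open>\<not> f x \<le> g x\<close> by (simp add: diff_eq_0_iff_ennreal)
    qed
  qed
qed

abbreviation uniform01 :: "real measure" where
  "uniform01 \<equiv> uniform_measure lborel {0<..1}"

lemma prob_space_uniform01: "prob_space uniform01"
  by (rule prob_space_uniform_measure) auto

lemma emeasure_uniform01_atMost:
  assumes "0 \<le> c" "c \<le> 1"
  shows "emeasure uniform01 {..c} = ennreal c"
proof -
  have "{0<..1} \<inter> {..c} = {0<..c}" using assms by auto
  then show ?thesis using assms divide_ennreal[of c 1] by simp
qed

text \<open>The family \<^term>\<open>M\<close> plays the role of \<open>x \<mapsto> P({..x} \<times> \<cdot>)\<close>. Its Radon-Nikodym densities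
  with respect to \<^term>\<open>N\<close> are conditional cdfs, and the witness is the conditional quantile.\<close>

lemma conditional_quantile:
  fixes \<mu> N :: "real measure" and M :: "real \<Rightarrow> real measure"
  assumes \<mu>: "real_distribution \<mu>" and N: "real_distribution N"
    and sets_M: "\<And>x. sets (M x) = sets borel"
    and mono: "\<And>x x' A. x \<le> x' \<Longrightarrow> emeasure (M x) A \<le> emeasure (M x') A"
    and le: "\<And>x A. emeasure (M x) A \<le> emeasure N A"
    and mass: "\<And>x. measure (M x) UNIV = cdf \<mu> x"
  obtains f where "f \<in> borel_measurable (borel \<Otimes>\<^sub>M borel)"
    and "\<And>x A. A \<in> sets borel \<Longrightarrow>
      emeasure (N \<Otimes>\<^sub>M uniform01) {p. f p \<le> x \<and> fst p \<in> A} = emeasure (M x) A"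
proof -
  interpret \<mu>: real_distribution \<mu> by fact
  interpret N: real_distribution N by fact
  interpret U: prob_space uniform01 by (rule prob_space_uniform01)
  interpret NU: pair_prob_space N uniform01 ..
  define W where "W = N \<Otimes>\<^sub>M uniform01"
  interpret W: prob_space W unfolding W_def by unfold_locales
  have sets_W[measurable_cong]: "sets W = sets (borel \<Otimes>\<^sub>M borel)"
    unfolding W_def by (intro sets_pair_measure_cong) auto
  have space_W: "space W = UNIV" unfolding W_def by (simp add: space_pair_measure)
  have space_M: "space (M x) = UNIV" for x using sets_eq_imp_space_eq[OF sets_M[of x]] by simp
  have fin_M: "finite_measure (M x)" for x
    using le[of x UNIV] by (intro finite_measureI) (auto simp: space_M N.emeasure_eq_measure top_unique)
  have meas_M: "emeasure (M x) A = ennreal (measure (M x) A)" for x A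
    using finite_measure.emeasure_eq_measure[OF fin_M] .
  \<comment> \<open>Truncating the density at 1 alters it only on a null set. Afterwards it is a
    number in [0, 1] at every point, so a uniform variable lies below it with exactly that
    probability.\<close>
  have "\<exists>k. k \<in> borel_measurable borel \<and> (\<forall>y. 0 \<le> k y \<and> k y \<le> (1::real)) \<and>
      density N (\<lambda>y. ennreal (k y)) = M x" for x
  proof -
    have "absolutely_continuous N (M x)"
      using le[of x] by (auto simp: absolutely_continuous_def null_sets_def sets_M) (metis le_zero_eq)
    from N.Radon_Nikodym[OF this] sets_M obtain h where
      h[measurable]: "h \<in> borel_measurable N" and hM: "density N h = M x" by auto
    have "AE y in N. h y \<le> 1"
      by (rule density_le_imp_AE_le) (use hM le[of x] in \<open>auto simp: density_1 N.emeasure_eq_measure\<close>)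
    then have "AE y in N. h y = ennreal (enn2real (min 1 (h y)))"
    proof eventually_elim
      case (elim y)
      then have "h y \<noteq> top" by (auto simp: top_unique)
      then show ?case using elim by (simp add: min_absorb2 less_top)
    qed
    then have "density N h = density N (\<lambda>y. ennreal (enn2real (min 1 (h y))))"
      by (intro density_cong) auto
    moreover have "enn2real (min 1 (h y)) \<le> 1" for y
      by (metis enn2real_mono enn2real_1 ennreal_one_less_top min.cobounded1)
    ultimately show ?thesis using hM
      by (intro exI[of _ "\<lambda>y. enn2real (min 1 (h y))"]) (auto simp: measurable_cong_sets[OF N.events_eq_borel])
  qed
  then obtain k where k[measurable]: "\<And>x. k x \<in> borel_measurable borel"
    and k01: "\<And>x y. 0 \<le> k x y" "\<And>x y. k x y \<le> (1::real)"
    and kM: "\<And>x. density N (\<lambda>y. ennreal (k x y)) = M x" by metis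
  have slice_sets: "{p. snd p \<le> k x (fst p) \<and> fst p \<in> A} \<in> sets (borel \<Otimes>\<^sub>M borel)"
    if [measurable]: "A \<in> sets borel" for x A
    by (rule sets_Collect_UNIV) (simp add: space_pair_measure, measurable)
  have slice: "emeasure W {p. snd p \<le> k x (fst p) \<and> fst p \<in> A} = emeasure (M x) A"
    if [measurable]: "A \<in> sets borel" for x A
  proof -
    have "emeasure W {p. snd p \<le> k x (fst p) \<and> fst p \<in> A} =
        (\<integral>\<^sup>+y. emeasure uniform01 (Pair y -` {p. snd p \<le> k x (fst p) \<and> fst p \<in> A}) \<partial>N)"
      using slice_sets[of A x]
      unfolding sets_W[symmetric] W_def by (intro U.emeasure_pair_measure_alt) auto
    also have "\<dots> = (\<integral>\<^sup>+y. ennreal (k x y) * indicator A y \<partial>N)"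
    proof (intro nn_integral_cong)
      fix y
      have "Pair y -` {p. snd p \<le> k x (fst p) \<and> fst p \<in> A} = (if y \<in> A then {..k x y} else {})"
        by auto
      then show "emeasure uniform01 (Pair y -` {p. snd p \<le> k x (fst p) \<and> fst p \<in> A})
          = ennreal (k x y) * indicator A y"
        using emeasure_uniform01_atMost[OF k01, of x y] by (auto simp del: emeasure_uniform_measure)
    qed
    also have "\<dots> = emeasure (M x) A"
      unfolding kM[symmetric] by (subst emeasure_density) auto
    finally show ?thesis .
  qed
  \<comment> \<open>Each comparison of two densities has its own exceptional null set, so
    monotonicity in the level holds almost everywhere only for countably many levels at
    once.\<close>
  have "AE y in N. \<forall>q r::rat. q \<le> r \<longrightarrow> k (of_rat q) y \<le> k (of_rat r) y"
  proof -
    have "AE y in N. q \<le> r \<longrightarrow> k (of_rat q) y \<le> k (of_rat r) y" for q r :: rat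
    proof (cases "q \<le> r")
      case True
      then have qr: "real_of_rat q \<le> of_rat r" by (simp add: of_rat_less_eq)
      have "AE y in N. ennreal (k (of_rat q) y) \<le> ennreal (k (of_rat r) y)"
        by (rule density_le_imp_AE_le) (use mono[OF qr] in \<open>auto simp: kM meas_M\<close>)
      then show ?thesis by eventually_elim (use k01 in auto)
    qed auto
    then show ?thesis by (simp add: AE_all_countable)
  qed
  then have "AE y in distr W N fst. \<forall>q r::rat. q \<le> r \<longrightarrow> k (of_rat q) y \<le> k (of_rat r) y"
    unfolding W_def U.distr_pair_fst .
  then have k_mono: "AE p in W. \<forall>q r::rat. q \<le> r \<longrightarrow> k (of_rat q) (fst p) \<le> k (of_rat r) (fst p)"
    by (rule AE_distrD[rotated]) (simp add: W_def)
  \<comment> \<open>The generalised inverse of the conditional cdf \<open>k\<close>, taken over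
    rational levels. It lives in the extended reals because the set of admissible levels may be
    empty or unbounded below.\<close>
  define F where "F p = (INF q::rat. if snd p \<le> k (of_rat q) (fst p) then ereal (of_rat q) else \<infinity>)" for p
  have F[measurable]: "F \<in> borel_measurable (borel \<Otimes>\<^sub>M borel)" unfolding F_def by measurable
  have F_sets: "{p. F p \<le> ereal x} \<in> sets W" "{p. F p = -\<infinity>} \<in> sets W" "{p. F p \<noteq> \<infinity>} \<in> sets W" for x
    unfolding sets_W by (rule sets_Collect_UNIV, simp add: space_pair_measure, measurable)+
  define m where "m x A = measure W {p. F p \<le> ereal x \<and> fst p \<in> A}" for x A
  have m_sets[measurable]: "{p. F p \<le> ereal x \<and> fst p \<in> A} \<in> sets (borel \<Otimes>\<^sub>M borel)"
    if [measurable]: "A \<in> sets borel" for x A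
    by (rule sets_Collect_UNIV) (simp add: space_pair_measure, measurable)
  have m_mono: "m x A \<le> m y A" if "x \<le> y" "A \<in> sets borel" for x y A
    unfolding m_def using that by (intro W.finite_measure_mono) (auto simp: sets_W intro: order_trans)
  have le_m: "measure (M (of_rat q)) A \<le> m (of_rat q) A" if A: "A \<in> sets borel" for q A
  proof -
    have "measure W {p. snd p \<le> k (of_rat q) (fst p) \<and> fst p \<in> A} \<le> m (of_rat q) A"
      unfolding m_def
    proof (intro W.finite_measure_mono subsetI)
      fix p assume "p \<in> {p. snd p \<le> k (of_rat q) (fst p) \<and> fst p \<in> A}"
      moreover from this have "F p \<le> ereal (of_rat q)"
        unfolding F_def by (intro INF_lower2[of q]) auto
      ultimately show "p \<in> {p. F p \<le> ereal (of_rat q) \<and> fst p \<in> A}" by auto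
    qed (use A in \<open>auto simp: sets_W\<close>)
    then show ?thesis using slice[OF A, of "of_rat q"] by (simp add: measure_def)
  qed
  \<comment> \<open>The infimum need not be attained, so \<open>F p \<le> x\<close> yields the slice
    only at rational levels strictly above \<open>x\<close>. The loss is repaired by right
    continuity in \<open>m_eq\<close>.\<close>
  have m_le: "m x A \<le> measure (M (of_rat q)) A" if A[measurable]: "A \<in> sets borel" and "x < of_rat q" for q x A
  proof -
    have "m x A \<le> measure W {p. snd p \<le> k (of_rat q) (fst p) \<and> fst p \<in> A}"
      unfolding m_def
    proof (intro W.finite_measure_mono_AE)
      show "AE p in W. p \<in> {p. F p \<le> ereal x \<and> fst p \<in> A} \<longrightarrow>
          p \<in> {p. snd p \<le> k (of_rat q) (fst p) \<and> fst p \<in> A}"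
        using k_mono
      proof eventually_elim
        case (elim p)
        show ?case
        proof safe
          assume "F p \<le> ereal x"
          then have "F p < ereal (of_rat q)" using that(2) by (metis ereal_less_eq(3) le_less_trans less_ereal.simps(1))
          then obtain r where r: "(if snd p \<le> k (of_rat r) (fst p) then ereal (of_rat r) else \<infinity>) < ereal (of_rat q)"
            unfolding F_def INF_less_iff by blast
          then have "snd p \<le> k (of_rat r) (fst p)" "r < q" by (auto split: if_splits simp: of_rat_less)
          then show "snd p \<le> k (of_rat q) (fst p)" using elim by (meson less_imp_le order_trans)
        qed
      qed
    qed (simp add: sets_W slice_sets)
    then show ?thesis using slice[OF A, of "of_rat q"] by (simp add: measure_def)
  qed
  \<comment> \<open>The increment of the family from \<open>x\<close> to \<open>x'\<close> is
    nonnegative on every set, so on \<open>A\<close> it is at most the total increment. Right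
    continuity of \<open>cdf \<mu>\<close> thereby passes to \<open>M\<close> on each set.\<close>
  have M_diff: "measure (M x') A \<le> measure (M x) A + (cdf \<mu> x' - cdf \<mu> x)" if A: "A \<in> sets borel" and xx: "x \<le> x'" for x x' A
  proof -
    have split: "measure (M z) UNIV = measure (M z) A + measure (M z) (- A)" for z
    proof -
      interpret finite_measure "M z" by (rule fin_M)
      show ?thesis using finite_measure_compl[of A] A by (simp add: space_M sets_M Compl_eq_Diff_UNIV)
    qed
    have "measure (M x) (- A) \<le> measure (M x') (- A)"
      using mono[OF xx, of "- A"] by (simp add: meas_M)
    then show ?thesis using split[of x] split[of x'] by (simp add: mass)
  qed
  have m_eq: "m x A = measure (M x) A" if A: "A \<in> sets borel" for x A
  proof (rule antisym)
    show "m x A \<le> measure (M x) A"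
    proof (rule field_le_epsilon)
      fix e :: real assume "0 < e"
      have "(cdf \<mu> \<longlongrightarrow> cdf \<mu> x) (at_right x)"
        using \<mu>.cdf_is_right_cont[of x] by (simp add: continuous_within)
      then have "eventually (\<lambda>z. cdf \<mu> z < cdf \<mu> x + e) (at_right x)"
        using \<open>0 < e\<close> by (intro order_tendstoD) auto
      then obtain b where b: "b > x" "\<And>z. x < z \<Longrightarrow> z < b \<Longrightarrow> cdf \<mu> z < cdf \<mu> x + e"
        unfolding eventually_at_right_field by auto
      obtain q where q: "x < of_rat q" "of_rat q < b" using of_rat_dense[OF b(1)] by auto
      have "m x A \<le> measure (M (of_rat q)) A" by (rule m_le[OF A q(1)])
      also have "\<dots> \<le> measure (M x) A + (cdf \<mu> (of_rat q) - cdf \<mu> x)"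
        using M_diff[OF A] q by simp
      finally show "m x A \<le> measure (M x) A + e" using b(2)[OF q] by simp
    qed
    have "(\<lambda>n. m (x + 1 / Suc n) A) \<longlonglongrightarrow> measure W (\<Inter>n. {p. F p \<le> ereal (x + 1 / Suc n) \<and> fst p \<in> A})"
      unfolding m_def
    proof (intro W.finite_Lim_measure_decseq)
      show "decseq (\<lambda>n. {p. F p \<le> ereal (x + 1 / Suc n) \<and> fst p \<in> A})"
      proof (intro monotoneI)
        fix m n :: nat assume "m \<le> n"
        then have "1 / real (Suc n) \<le> 1 / real (Suc m)" by (simp add: divide_simps)
        then have "ereal (x + 1 / Suc n) \<le> ereal (x + 1 / Suc m)" by simp
        then show "{p. F p \<le> ereal (x + 1 / Suc m) \<and> fst p \<in> A} \<ge> {p. F p \<le> ereal (x + 1 / Suc n) \<and> fst p \<in> A}"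
          by (auto intro: order_trans)
      qed
    qed (use A in \<open>auto simp: sets_W\<close>)
    also have "(\<Inter>n. {p. F p \<le> ereal (x + 1 / Suc n) \<and> fst p \<in> A}) = {p. F p \<le> ereal x \<and> fst p \<in> A}"
    proof safe
      fix y u assume *: "(y, u) \<in> (\<Inter>n. {p. F p \<le> ereal (x + 1 / Suc n) \<and> fst p \<in> A})"
      then show "fst (y, u) \<in> A" by auto
      show "F (y, u) \<le> ereal x"
      proof (rule ereal_le_epsilon2)
        fix e :: real assume "0 < e"
        then obtain n where "1 / real (Suc n) < e" using nat_approx_posE by blast
        moreover have "F (y, u) \<le> ereal (x + 1 / Suc n)" using * by auto
        ultimately show "F (y, u) \<le> ereal x + ereal e" by (auto elim: order_trans)
      qed
    next
      fix y u n assume "F (y, u) \<le> ereal x"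
      also have "ereal x \<le> ereal (x + 1 / real (Suc n))" by simp
      finally show "F (y, u) \<le> ereal (x + 1 / real (Suc n))" .
    qed
    finally have lim: "(\<lambda>n. m (x + 1 / Suc n) A) \<longlonglongrightarrow> m x A" unfolding m_def .
    have "measure (M x) A \<le> m (x + 1 / Suc n) A" for n
    proof -
      obtain q where q: "x < of_rat q" "of_rat q < x + 1 / Suc n" using of_rat_dense[of x "x + 1 / Suc n"] by auto
      have "measure (M x) A \<le> measure (M (of_rat q)) A" using mono[of x "of_rat q" A] q by (simp add: meas_M)
      also have "\<dots> \<le> m (of_rat q) A" by (rule le_m[OF A])
      also have "\<dots> \<le> m (x + 1 / Suc n) A" using q A by (intro m_mono) auto
      finally show ?thesis .
    qed
    then show "measure (M x) A \<le> m x A" by (intro LIMSEQ_le_const[OF lim]) auto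
  qed
  have m_UNIV: "measure W {p. F p \<le> ereal x} = cdf \<mu> x" for x
    using m_eq[of UNIV x] by (simp add: m_def mass)
  \<comment> \<open>Mass at the values \<open>-\<infinity>\<close> or \<open>\<infinity>\<close>
    would contradict the limits 0 and 1 of \<open>cdf \<mu>\<close>.\<close>
  have "AE p in W. F p \<noteq> -\<infinity>"
  proof -
    have "measure W {p. F p = -\<infinity>} \<le> cdf \<mu> x" for x
      unfolding m_UNIV[symmetric] by (intro W.finite_measure_mono F_sets) auto
    then have "measure W {p. F p = -\<infinity>} \<le> 0"
      by (intro tendsto_lowerbound[OF \<mu>.cdf_lim_at_bot]) (auto simp: trivial_limit_at_bot_linorder)
    then have "measure W {p. F p = -\<infinity>} = 0" by (simp add: measure_le_0_iff)
    then show ?thesis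
      by (subst AE_iff_measurable[OF _ refl]) (auto simp: space_W F_sets W.emeasure_eq_measure)
  qed
  moreover have "AE p in W. F p \<noteq> \<infinity>"
  proof -
    have "cdf \<mu> x \<le> measure W {p. F p \<noteq> \<infinity>}" for x
      unfolding m_UNIV[symmetric] by (intro W.finite_measure_mono F_sets) auto
    then have "1 \<le> measure W {p. F p \<noteq> \<infinity>}"
      by (intro tendsto_upperbound[OF \<mu>.cdf_lim_at_top_prob]) (auto simp: trivial_limit_at_top_linorder)
    then have "measure W {p\<in>space W. F p \<noteq> \<infinity>} = 1" by (simp add: W.measure_ge_1_iff space_W)
    then show ?thesis using F_sets(3) by (subst (asm) W.prob_Collect_eq_1) (auto simp: space_W)
  qed
  ultimately have fin: "AE p in W. \<bar>F p\<bar> \<noteq> \<infinity>" by eventually_elim auto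
  show thesis
  proof
    show [measurable]: "(\<lambda>p. real_of_ereal (F p)) \<in> borel_measurable (borel \<Otimes>\<^sub>M borel)" by measurable
    fix x A assume A[measurable]: "A \<in> sets (borel :: real measure)"
    have "measure W {p. real_of_ereal (F p) \<le> x \<and> fst p \<in> A} = m x A"
      unfolding m_def
    proof (rule W.finite_measure_eq_AE)
      show "{p. real_of_ereal (F p) \<le> x \<and> fst p \<in> A} \<in> sets W"
        unfolding sets_W by (rule sets_Collect_UNIV) (simp add: space_pair_measure, measurable)
      show "AE p in W. (p \<in> {p. real_of_ereal (F p) \<le> x \<and> fst p \<in> A}) = (p \<in> {p. F p \<le> ereal x \<and> fst p \<in> A})"
        using fin by eventually_elim (auto simp: real_le_ereal_iff)
    qed (auto simp: sets_W)
    then show "emeasure (N \<Otimes>\<^sub>M uniform01) {p. real_of_ereal (F p) \<le> x \<and> fst p \<in> A} = emeasure (M x) A"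
      using m_eq[OF A] by (simp add: W_def[symmetric] W.emeasure_eq_measure meas_M)
  qed
qed

section \<open>The alternating Markov chain\<close>

lemma measure_eqI_quadrants:
  fixes P Q :: "(real \<times> real) measure"
  assumes "finite_measure P" "sets P = sets borel" "sets Q = sets borel"
    and eq: "\<And>x y. emeasure P ({..x} \<times> {..y}) = emeasure Q ({..x} \<times> {..y})"
  shows "P = Q"
proof (rule measure_eqI_generator_eq)
  let ?E = "range (\<lambda>(x, y). {..x::real} \<times> {..y::real})"
  let ?A = "\<lambda>n::nat. {..real n} \<times> {..real n}"
  have E: "?E = range (\<lambda>a. {..a::real \<times> real})"
    by (auto simp: image_def set_eq_iff)
  have "sets (borel :: (real \<times> real) measure) = sigma_sets UNIV ?E"
    unfolding E borel_eq_atMost by simp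
  then show "sets P = sigma_sets UNIV ?E" "sets Q = sigma_sets UNIV ?E"
    using assms by auto
  show "Int_stable ?E"
  proof (rule Int_stableI_image, clarsimp)
    fix a b c d :: real
    show "\<exists>x y. ({..a} \<times> {..b}) \<inter> ({..c} \<times> {..d}) = {..x} \<times> {..y}"
      by (intro exI[of _ "min a c"] exI[of _ "min b d"]) auto
  qed
  show "range ?A \<subseteq> ?E" by auto
  show "(\<Union>n. ?A n) = UNIV"
  proof (intro equalityI subsetI UNIV_I)
    fix p :: "real \<times> real"
    obtain n where "max (fst p) (snd p) \<le> real n" using real_arch_simple by blast
    then show "p \<in> (\<Union>n. ?A n)" by (cases p) (auto intro!: exI[of _ n])
  qed
  show "emeasure P (?A n) \<noteq> \<infinity>" for n
    using assms(1) by (simp add: finite_measure.emeasure_finite)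
qed (use eq in auto)

text \<open>Slices over \<open>{..x}\<close> are the input for \<open>conditional_quantile\<close>;
  slices over \<open>{x<..}\<close> are the candidates for \<open>minimal_target\<close>.\<close>

definition slice :: "(real \<times> real) measure \<Rightarrow> real set \<Rightarrow> real measure" where
  "slice P B = distr (density P (indicator (B \<times> UNIV))) borel snd"

lemma sets_slice [simp]: "sets (slice P B) = sets borel"
  by (simp add: slice_def)

lemma emeasure_slice:
  assumes [simp]: "sets P = sets borel" and [measurable]: "A \<in> sets borel" "B \<in> sets borel"
  shows "emeasure (slice P B) A = emeasure P (B \<times> A)"
proof -
  have space: "space P = UNIV" using sets_eq_imp_space_eq[OF assms(1)] by simp
  have BU: "B \<times> UNIV \<in> sets (borel :: (real \<times> real) measure)"
    unfolding borel_prod[symmetric] by measurable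
  have [measurable]: "snd \<in> measurable P (borel :: real measure)"
    unfolding measurable_cong_sets[OF assms(1) refl] borel_prod[symmetric] by measurable
  have UA: "snd -` A \<in> sets P"
    using measurable_sets[of snd P borel A] space by simp
  have "emeasure (slice P B) A = emeasure (density P (indicator (B \<times> UNIV))) (snd -` A)"
    unfolding slice_def by (subst emeasure_distr) (auto simp: space)
  also have "\<dots> = emeasure P ((B \<times> UNIV) \<inter> snd -` A)"
    using BU UA by (intro emeasure_restricted) auto
  also have "(B \<times> UNIV) \<inter> snd -` A = B \<times> A" by auto
  finally show ?thesis .
qed

text \<open>A disintegration in functional form: with \<open>u\<close> uniform,
  \<open>f (y, u)\<close> samples the first coordinate given that the second is \<open>y\<close>.
  Kernels of this form are iterated by feeding them fresh noise.\<close>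

lemma coupling_conditional_quantile:
  fixes P :: "(real \<times> real) measure"
  assumes "prob_space P" and sets_P: "sets P = sets borel"
  obtains f where "f \<in> borel_measurable (borel \<Otimes>\<^sub>M borel)"
    and "P = distr (distr P borel snd \<Otimes>\<^sub>M uniform01) borel (\<lambda>p. (f p, fst p))"
proof -
  interpret P: prob_space P by fact
  have space_P: "space P = UNIV" using sets_eq_imp_space_eq[OF sets_P] by simp
  have [measurable_cong]: "sets P = sets (borel \<Otimes>\<^sub>M borel)" using sets_P by (simp only: borel_prod)
  define \<mu> \<nu> where "\<mu> = distr P borel fst" and "\<nu> = distr P borel snd"
  interpret \<mu>: real_distribution \<mu> unfolding \<mu>_def by (rule P.real_distribution_distr) measurable
  interpret \<nu>: real_distribution \<nu> unfolding \<nu>_def by (rule P.real_distribution_distr) measurable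
  interpret U: prob_space uniform01 by (rule prob_space_uniform01)
  interpret W: pair_prob_space \<nu> uniform01 ..
  have rect: "B \<times> A \<in> sets P" if "A \<in> sets borel" "B \<in> sets borel" for A B :: "real set"
    using that by (simp add: sets_P borel_prod[symmetric])
  have em: "emeasure (slice P {..x}) A = (if A \<in> sets borel then emeasure P ({..x} \<times> A) else 0)" for x A
    by (auto simp: emeasure_slice[OF sets_P] emeasure_notin_sets)
  obtain f where f[measurable]: "f \<in> borel_measurable (borel \<Otimes>\<^sub>M borel)"
    and law: "\<And>x A. A \<in> sets borel \<Longrightarrow>
      emeasure (\<nu> \<Otimes>\<^sub>M uniform01) {p. f p \<le> x \<and> fst p \<in> A} = emeasure (slice P {..x}) A"
  proof (rule conditional_quantile[where \<mu>=\<mu> and N=\<nu> and M="\<lambda>x. slice P {..x}"])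
    show "real_distribution \<mu>" "real_distribution \<nu>" by unfold_locales
    show "emeasure (slice P {..x}) A \<le> emeasure (slice P {..x'}) A" if "x \<le> x'" for x x' A
      unfolding em using that rect[of A] by (auto intro!: emeasure_mono)
    show "emeasure (slice P {..x}) A \<le> emeasure \<nu> A" for x A
    proof (cases "A \<in> sets borel")
      case True
      then have "emeasure \<nu> A = emeasure P (UNIV \<times> A)"
        unfolding \<nu>_def by (subst emeasure_distr) (auto simp: space_P vimage_def intro!: arg_cong[where f="emeasure P"])
      then show ?thesis unfolding em using True rect[of A UNIV] by (auto intro!: emeasure_mono)
    qed (simp add: em)
    show "measure (slice P {..x}) UNIV = cdf \<mu> x" for x
    proof -
      have "cdf \<mu> x = measure P ({..x} \<times> UNIV)"
        unfolding \<mu>_def cdf_def by (subst measure_distr) (auto simp: space_P vimage_def intro!: arg_cong[where f="measure P"])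
      then show ?thesis by (simp add: measure_def em)
    qed
  qed auto
  have "P = distr (\<nu> \<Otimes>\<^sub>M uniform01) borel (\<lambda>p. (f p, fst p))"
  proof (rule measure_eqI_quadrants)
    fix x y
    have "emeasure (distr (\<nu> \<Otimes>\<^sub>M uniform01) borel (\<lambda>p. (f p, fst p))) ({..x} \<times> {..y})
        = emeasure (\<nu> \<Otimes>\<^sub>M uniform01) {p. f p \<le> x \<and> fst p \<in> {..y}}"
      unfolding borel_prod[symmetric]
      by (subst emeasure_distr) (auto simp: space_pair_measure intro!: arg_cong[where f="emeasure (\<nu> \<Otimes>\<^sub>M uniform01)"])
    then show "emeasure P ({..x} \<times> {..y}) = emeasure (distr (\<nu> \<Otimes>\<^sub>M uniform01) borel (\<lambda>p. (f p, fst p))) ({..x} \<times> {..y})"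
      using law[of "{..y}" x] by (simp add: em)
  qed (use P.finite_measure_axioms sets_P in auto)
  then show thesis using that f unfolding \<nu>_def by blast
qed

lemma measure_eqI_indicator:
  assumes "sets A = sets B"
    and "\<And>E. E \<in> sets A \<Longrightarrow> (\<integral>\<^sup>+w. indicator E w \<partial>A) = (\<integral>\<^sup>+w. indicator E w \<partial>B)"
  shows "A = B"
  using assms by (intro measure_eqI) auto

text \<open>The shift of the stationary Markov chain that alternates steps of the two couplings: from
  \<open>x\<close> to \<open>y\<close> according to \<^term>\<open>P\<close>, then from \<open>y\<close> to the next \<open>x\<close> according to \<^term>\<open>Q\<close>.\<close>

lemma alternating_chain:
  fixes P Q :: "(real \<times> real) measure"
  assumes P: "prob_space P" "sets P = sets borel" and Q: "prob_space Q" "sets Q = sets borel"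
    and fst_eq: "distr P borel fst = distr Q borel fst" and snd_eq: "distr P borel snd = distr Q borel snd"
  obtains W :: "(real \<times> (real \<times> real) stream) measure" and T X Y
  where "prob_space W" "T \<in> measurable W W" "distr W W T = W"
    "X \<in> borel_measurable W" "Y \<in> borel_measurable W"
    "distr W borel (\<lambda>w. (X w, Y w)) = P" "distr W borel (\<lambda>w. (X (T w), Y w)) = Q"
proof -
  interpret P: prob_space P by fact
  interpret Q: prob_space Q by fact
  have [measurable_cong]: "sets P = sets (borel \<Otimes>\<^sub>M borel)" using P by (simp only: borel_prod)
  have [measurable_cong]: "sets Q = sets (borel \<Otimes>\<^sub>M borel)" using Q by (simp only: borel_prod)
  define \<mu> \<nu> where "\<mu> = distr P borel fst" and "\<nu> = distr P borel snd"
  interpret \<mu>: real_distribution \<mu> unfolding \<mu>_def by (rule P.real_distribution_distr) measurable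
  interpret \<nu>: real_distribution \<nu> unfolding \<nu>_def by (rule P.real_distribution_distr) measurable
  interpret U: prob_space uniform01 by (rule prob_space_uniform01)
  \<comment> \<open>Quantiles are conditional on the second coordinate. Swapping the coordinates of
    \<open>P\<close> yields the step from \<open>x\<close> to \<open>y\<close>; the step back is
    obtained from \<open>Q\<close> as it stands.\<close>
  define P' where "P' = distr P borel (\<lambda>(x, y). (y, x))"
  have P': "prob_space P'" unfolding P'_def borel_prod[symmetric] by (rule P.prob_space_distr) measurable
  obtain h where h[measurable]: "h \<in> borel_measurable (borel \<Otimes>\<^sub>M borel)"
    and h_law: "P' = distr (distr P' borel snd \<Otimes>\<^sub>M uniform01) borel (\<lambda>p. (h p, fst p))"
    using coupling_conditional_quantile[OF P'] by (auto simp: P'_def)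
  have swap_meas: "(\<lambda>(x::real, y::real). (y, x)) \<in> borel \<rightarrow>\<^sub>M borel"
    unfolding borel_prod[symmetric] by measurable
  have "distr P' borel snd = \<mu>"
    unfolding P'_def \<mu>_def using swap_meas
    by (subst distr_distr) (auto simp: measurable_cong_sets[OF P(2) refl] comp_def case_prod_beta' borel_prod[symmetric])
  with h_law have h_law: "P' = distr (\<mu> \<Otimes>\<^sub>M uniform01) borel (\<lambda>p. (h p, fst p))" by simp
  obtain f where f[measurable]: "f \<in> borel_measurable (borel \<Otimes>\<^sub>M borel)"
    and f_law: "Q = distr (\<nu> \<Otimes>\<^sub>M uniform01) borel (\<lambda>p. (f p, fst p))"
    using coupling_conditional_quantile[OF Q] unfolding \<nu>_def snd_eq by auto
  have P_law: "distr (\<mu> \<Otimes>\<^sub>M uniform01) borel (\<lambda>p. (fst p, h p)) = P"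
  proof -
    have "distr P' borel (\<lambda>(x, y). (y, x)) = P"
      unfolding P'_def using swap_meas P(2)
      by (subst distr_distr) (auto simp: measurable_cong_sets[OF P(2) refl] comp_def case_prod_beta' distr_id2)
    moreover have "distr P' borel (\<lambda>(x, y). (y, x)) = distr (\<mu> \<Otimes>\<^sub>M uniform01) borel (\<lambda>p. (fst p, h p))"
      unfolding h_law using swap_meas
      by (subst distr_distr) (auto simp: comp_def borel_prod[symmetric])
    ultimately show ?thesis by simp
  qed
  have h_\<nu>: "distr (\<mu> \<Otimes>\<^sub>M uniform01) borel h = \<nu>"
    unfolding \<nu>_def P_law[symmetric]
    by (subst distr_distr) (auto simp: comp_def borel_prod[symmetric])
  define UU where "UU = uniform01 \<Otimes>\<^sub>M uniform01"
  interpret UUp: pair_prob_space uniform01 uniform01 ..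
  interpret UU: prob_space UU unfolding UU_def by unfold_locales
  interpret S: prob_space "stream_space UU" by (rule UU.prob_space_stream_space)
  have UU_sets[measurable_cong]: "sets UU = sets (borel \<Otimes>\<^sub>M borel)"
    unfolding UU_def by (intro sets_pair_measure_cong) auto
  define W where "W = \<mu> \<Otimes>\<^sub>M stream_space UU"
  interpret Wp: pair_prob_space \<mu> "stream_space UU" ..
  define X where "X = (fst :: real \<times> (real \<times> real) stream \<Rightarrow> real)"
  define Y where "Y w = h (fst w, fst (shd (snd w)))" for w :: "real \<times> (real \<times> real) stream"
  define T where "T w = (f (Y w, snd (shd (snd w))), stl (snd w))" for w :: "real \<times> (real \<times> real) stream"
  have X[measurable]: "X \<in> borel_measurable W" unfolding X_def W_def by measurable
  have Y[measurable]: "Y \<in> borel_measurable W" unfolding Y_def[abs_def] W_def by measurable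
  have T[measurable]: "T \<in> measurable W W"
    unfolding T_def[abs_def] Y_def W_def by measurable
  have int_W: "(\<integral>\<^sup>+w. F w \<partial>W) =
      (\<integral>\<^sup>+x. \<integral>\<^sup>+u. \<integral>\<^sup>+v. \<integral>\<^sup>+s. F (x, (u, v) ## s) \<partial>stream_space UU \<partial>uniform01 \<partial>uniform01 \<partial>\<mu>)"
    if F: "F \<in> borel_measurable W" for F
  proof -
    have [measurable]: "F \<in> borel_measurable (\<mu> \<Otimes>\<^sub>M stream_space UU)" using F by (simp add: W_def)
    have "(\<integral>\<^sup>+w. F w \<partial>W) = (\<integral>\<^sup>+x. \<integral>\<^sup>+s. F (x, s) \<partial>stream_space UU \<partial>\<mu>)"
      unfolding W_def by (rule S.nn_integral_fst[symmetric]) measurable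
    also have "\<dots> = (\<integral>\<^sup>+x. \<integral>\<^sup>+p. \<integral>\<^sup>+s. F (x, p ## s) \<partial>stream_space UU \<partial>UU \<partial>\<mu>)"
      by (intro nn_integral_cong UU.nn_integral_stream_space) measurable
    also have "\<dots> = (\<integral>\<^sup>+x. \<integral>\<^sup>+u. \<integral>\<^sup>+v. \<integral>\<^sup>+s. F (x, (u, v) ## s) \<partial>stream_space UU \<partial>uniform01 \<partial>uniform01 \<partial>\<mu>)"
    proof (intro nn_integral_cong)
      fix x
      have [measurable]: "(\<lambda>p. \<integral>\<^sup>+s. F (x, p ## s) \<partial>stream_space UU) \<in> borel_measurable UU" by measurable
      then show "(\<integral>\<^sup>+p. \<integral>\<^sup>+s. F (x, p ## s) \<partial>stream_space UU \<partial>UU) =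
        (\<integral>\<^sup>+u. \<integral>\<^sup>+v. \<integral>\<^sup>+s. F (x, (u, v) ## s) \<partial>stream_space UU \<partial>uniform01 \<partial>uniform01)"
        unfolding UU_def by (rule U.nn_integral_fst[symmetric])
    qed
    finally show ?thesis .
  qed
  have int_h: "(\<integral>\<^sup>+x. \<integral>\<^sup>+u. F (h (x, u)) \<partial>uniform01 \<partial>\<mu>) = (\<integral>\<^sup>+y. F y \<partial>\<nu>)"
    if [measurable]: "F \<in> borel_measurable borel" for F
  proof -
    have "(\<integral>\<^sup>+y. F y \<partial>\<nu>) = (\<integral>\<^sup>+p. F (h p) \<partial>(\<mu> \<Otimes>\<^sub>M uniform01))"
      unfolding h_\<nu>[symmetric] by (rule nn_integral_distr) measurable
    also have "\<dots> = (\<integral>\<^sup>+x. \<integral>\<^sup>+u. F (h (x, u)) \<partial>uniform01 \<partial>\<mu>)"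
      by (rule U.nn_integral_fst[symmetric]) measurable
    finally show ?thesis ..
  qed
  have f_\<mu>: "distr (\<nu> \<Otimes>\<^sub>M uniform01) borel f = \<mu>"
    unfolding \<mu>_def fst_eq f_law
    by (subst distr_distr) (auto simp: comp_def borel_prod[symmetric])
  have int_f: "(\<integral>\<^sup>+x. \<integral>\<^sup>+u. F (f (x, u)) \<partial>uniform01 \<partial>\<nu>) = (\<integral>\<^sup>+y. F y \<partial>\<mu>)"
    if [measurable]: "F \<in> borel_measurable borel" for F
  proof -
    have "(\<integral>\<^sup>+y. F y \<partial>\<mu>) = (\<integral>\<^sup>+p. F (f p) \<partial>(\<nu> \<Otimes>\<^sub>M uniform01))"
      unfolding f_\<mu>[symmetric] by (rule nn_integral_distr) measurable
    also have "\<dots> = (\<integral>\<^sup>+x. \<integral>\<^sup>+u. F (f (x, u)) \<partial>uniform01 \<partial>\<nu>)"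
      by (rule U.nn_integral_fst[symmetric]) measurable
    finally show ?thesis ..
  qed
  show thesis
  proof
    show "prob_space W" unfolding W_def by unfold_locales
    show "distr W borel (\<lambda>w. (X w, Y w)) = P"
    proof (rule measure_eqI_indicator)
      fix E assume "E \<in> sets (distr W borel (\<lambda>w. (X w, Y w)))"
      then have [measurable]: "E \<in> sets (borel \<Otimes>\<^sub>M borel)" by (simp only: sets_distr borel_prod)
      have F: "(\<lambda>w. indicator E (X w, Y w) :: ennreal) \<in> borel_measurable W" by measurable
      have "(\<integral>\<^sup>+w. indicator E w \<partial>distr W (borel \<Otimes>\<^sub>M borel) (\<lambda>w. (X w, Y w))) = (\<integral>\<^sup>+w. indicator E (X w, Y w) \<partial>W)"
        by (rule nn_integral_distr) measurable
      also have "\<dots> = (\<integral>\<^sup>+x. \<integral>\<^sup>+u. indicator E (x, h (x, u)) \<partial>uniform01 \<partial>\<mu>)"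
        by (subst int_W[OF F]) (simp add: X_def Y_def S.emeasure_space_1 U.emeasure_space_1)
      also have "\<dots> = (\<integral>\<^sup>+p. indicator E (fst p, h p) \<partial>(\<mu> \<Otimes>\<^sub>M uniform01))"
        by (subst U.nn_integral_fst[symmetric]) auto
      also have "\<dots> = (\<integral>\<^sup>+w. indicator E w \<partial>distr (\<mu> \<Otimes>\<^sub>M uniform01) (borel \<Otimes>\<^sub>M borel) (\<lambda>p. (fst p, h p)))"
        by (rule nn_integral_distr[symmetric]) measurable
      finally show "(\<integral>\<^sup>+w. indicator E w \<partial>distr W borel (\<lambda>w. (X w, Y w))) = (\<integral>\<^sup>+w. indicator E w \<partial>P)"
        by (simp only: borel_prod P_law)
    qed (use P in simp)
    show "distr W borel (\<lambda>w. (X (T w), Y w)) = Q"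
    proof (rule measure_eqI_indicator)
      fix E assume "E \<in> sets (distr W borel (\<lambda>w. (X (T w), Y w)))"
      then have [measurable]: "E \<in> sets (borel \<Otimes>\<^sub>M borel)" by (simp only: sets_distr borel_prod)
      have F: "(\<lambda>w. indicator E (X (T w), Y w) :: ennreal) \<in> borel_measurable W" by measurable
      have "(\<integral>\<^sup>+w. indicator E w \<partial>distr W (borel \<Otimes>\<^sub>M borel) (\<lambda>w. (X (T w), Y w))) = (\<integral>\<^sup>+w. indicator E (X (T w), Y w) \<partial>W)"
        by (rule nn_integral_distr) measurable
      also have "\<dots> = (\<integral>\<^sup>+x. \<integral>\<^sup>+u. (\<integral>\<^sup>+v. indicator E (f (h (x, u), v), h (x, u)) \<partial>uniform01) \<partial>uniform01 \<partial>\<mu>)"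
        by (subst int_W[OF F]) (simp add: X_def Y_def T_def S.emeasure_space_1)
      also have "\<dots> = (\<integral>\<^sup>+y. (\<integral>\<^sup>+v. indicator E (f (y, v), y) \<partial>uniform01) \<partial>\<nu>)"
        by (rule int_h) measurable
      also have "\<dots> = (\<integral>\<^sup>+p. indicator E (f p, fst p) \<partial>(\<nu> \<Otimes>\<^sub>M uniform01))"
        by (subst U.nn_integral_fst[symmetric]) auto
      also have "\<dots> = (\<integral>\<^sup>+w. indicator E w \<partial>distr (\<nu> \<Otimes>\<^sub>M uniform01) (borel \<Otimes>\<^sub>M borel) (\<lambda>p. (f p, fst p)))"
        by (rule nn_integral_distr[symmetric]) measurable
      finally show "(\<integral>\<^sup>+w. indicator E w \<partial>distr W borel (\<lambda>w. (X (T w), Y w))) = (\<integral>\<^sup>+w. indicator E w \<partial>Q)"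
        by (simp only: borel_prod f_law[symmetric])
    qed (use Q in simp)
    \<comment> \<open>\<open>h\<close> carries \<mu> to \<nu> and \<open>f\<close> carries \<nu>
      back to \<mu>, because the couplings share both marginals; the tail of the stream is
      independent of these two steps and has the law of the whole stream.\<close>
    show "distr W W T = W"
    proof (rule measure_eqI_indicator)
      fix E assume "E \<in> sets (distr W W T)"
      then have E[measurable]: "E \<in> sets W" by simp
      then have [measurable]: "E \<in> sets (borel \<Otimes>\<^sub>M stream_space UU)"
        unfolding W_def by (simp cong: sets_pair_measure_cong)
      have [measurable]: "(\<lambda>x. \<integral>\<^sup>+s. indicator E (x, s) \<partial>stream_space UU) \<in> borel_measurable borel"
        by measurable
      have F: "(\<lambda>w. indicator E (T w) :: ennreal) \<in> borel_measurable W" by measurable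
      have "(\<integral>\<^sup>+w. indicator E w \<partial>distr W W T) = (\<integral>\<^sup>+w. indicator E (T w) \<partial>W)"
        by (rule nn_integral_distr) measurable
      also have "\<dots> = (\<integral>\<^sup>+x. \<integral>\<^sup>+u. (\<integral>\<^sup>+v. (\<integral>\<^sup>+s. indicator E (f (h (x, u), v), s) \<partial>stream_space UU) \<partial>uniform01) \<partial>uniform01 \<partial>\<mu>)"
        by (subst int_W[OF F]) (simp add: Y_def T_def)
      also have "\<dots> = (\<integral>\<^sup>+y. \<integral>\<^sup>+v. (\<integral>\<^sup>+s. indicator E (f (y, v), s) \<partial>stream_space UU) \<partial>uniform01 \<partial>\<nu>)"
        by (rule int_h) measurable
      also have "\<dots> = (\<integral>\<^sup>+x. \<integral>\<^sup>+s. indicator E (x, s) \<partial>stream_space UU \<partial>\<mu>)"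
        by (rule int_f) measurable
      also have "\<dots> = (\<integral>\<^sup>+w. indicator E w \<partial>W)"
        unfolding W_def by (rule S.nn_integral_fst) (use E in \<open>simp add: W_def\<close>)
      finally show "(\<integral>\<^sup>+w. indicator E w \<partial>distr W W T) = (\<integral>\<^sup>+w. indicator E w \<partial>W)" .
    qed simp
  qed fact+
qed

section \<open>Optimality of noncrossing couplings\<close>

lemma halfplane_borel [measurable]: "halfplane \<in> sets borel"
proof -
  have "closed {p :: real \<times> real. fst p \<le> snd p}"
    by (intro closed_Collect_le continuous_intros)
  moreover have "halfplane = {p. fst p \<le> snd p}" by (auto simp: halfplane_def)
  ultimately show ?thesis by simp
qed

lemma directional_couplingsD:
  assumes "Q \<in> directional_couplings \<mu> \<nu>"
  shows "prob_space Q" "sets Q = sets borel" "space Q = UNIV"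
    "distr Q borel fst = \<mu>" "distr Q borel snd = \<nu>" "AE p in Q. p \<in> halfplane"
proof -
  show Q: "prob_space Q" "sets Q = sets borel" "distr Q borel fst = \<mu>" "distr Q borel snd = \<nu>"
    using assms by (auto simp: directional_couplings_def)
  show "space Q = UNIV" using sets_eq_imp_space_eq[OF Q(2)] by simp
  interpret prob_space Q by fact
  show "AE p in Q. p \<in> halfplane"
    using assms by (intro AE_prob_1) (simp add: directional_couplings_def)
qed

lemma measurable_fst_snd_borel:
  assumes "sets Q = sets (borel :: (real \<times> real) measure)"
  shows "fst \<in> measurable Q borel" "snd \<in> measurable Q borel"
  unfolding measurable_cong_sets[OF assms refl] borel_prod[symmetric] by measurable

lemma reward_borel:
  fixes g :: "real \<times> real \<Rightarrow> real"
  assumes "g \<in> borel_measurable (restrict_space borel halfplane)"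
  shows "(\<lambda>p. indicator halfplane p *\<^sub>R g p) \<in> borel_measurable borel"
  using assms borel_measurable_restrict_space_iff[of halfplane borel g] by simp

lemma reward_integrable:
  assumes Q: "Q \<in> directional_couplings \<mu> \<nu>" and g: "marginal_integrable \<mu> \<nu> g"
    and meas: "g \<in> borel_measurable (restrict_space borel halfplane)"
  shows "integrable Q (\<lambda>p. indicator halfplane p *\<^sub>R g p)"
proof -
  note QD = directional_couplingsD[OF Q]
  note fs[measurable] = measurable_fst_snd_borel[OF QD(2)]
  obtain \<phi> \<psi> where \<phi>: "integrable \<mu> \<phi>" and \<psi>: "integrable \<nu> \<psi>"
    and bound: "\<And>x y. x \<le> y \<Longrightarrow> \<bar>g (x, y)\<bar> \<le> \<phi> x + \<psi> y"
    using g by (auto simp: marginal_integrable_def halfplane_def)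
  have "integrable Q (\<lambda>p. \<phi> (fst p))"
    using \<phi> unfolding QD(4)[symmetric] by (rule integrable_distr[OF fs(1)])
  moreover have "integrable Q (\<lambda>p. \<psi> (snd p))"
    using \<psi> unfolding QD(5)[symmetric] by (rule integrable_distr[OF fs(2)])
  ultimately have "integrable Q (\<lambda>p. \<phi> (fst p) + \<psi> (snd p))" by (rule Bochner_Integration.integrable_add)
  then show ?thesis
  proof (rule Bochner_Integration.integrable_bound)
    show "(\<lambda>p. indicator halfplane p *\<^sub>R g p) \<in> borel_measurable Q"
      using reward_borel[OF meas] unfolding measurable_cong_sets[OF QD(2) refl] .
    show "AE p in Q. norm (indicator halfplane p *\<^sub>R g p) \<le> norm (\<phi> (fst p) + \<psi> (snd p))"
      using QD(6)
    proof eventually_elim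
      case (elim p)
      then show ?case using bound[of "fst p" "snd p"] by (auto simp: halfplane_def)
    qed
  qed
qed

lemma noncrossing_optimal:
  assumes P: "P \<in> directional_couplings \<mu> \<nu>" and Q: "Q \<in> directional_couplings \<mu> \<nu>"
    and \<Gamma>: "\<Gamma> \<subseteq> halfplane" "constrained_crossing \<Gamma>" "supported_by P \<Gamma>"
    and int: "marginal_integrable \<mu> \<nu> g" and sub: "submodular g"
  shows "(LINT p:halfplane|Q. g p) \<le> (LINT p:halfplane|P. g p)"
proof -
  note PD = directional_couplingsD[OF P] and QD = directional_couplingsD[OF Q]
  define g1 where "g1 p = indicator halfplane p *\<^sub>R g p" for p
  have meas: "g \<in> borel_measurable (restrict_space borel halfplane)"
    and sub': "\<And>x x' y y'. x < x' \<Longrightarrow> x' \<le> y \<Longrightarrow> y < y' \<Longrightarrow> g (x, y) + g (x', y') \<le> g (x, y') + g (x', y)"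
    using sub by (auto simp: submodular_def)
  have g1[measurable]: "g1 \<in> borel_measurable (borel \<Otimes>\<^sub>M borel)"
    using reward_borel[OF meas] unfolding g1_def[symmetric] borel_prod .
  have intP: "integrable P g1" and intQ: "integrable Q g1"
    using reward_integrable[OF P int meas] reward_integrable[OF Q int meas] unfolding g1_def[abs_def] .
  obtain \<phi> \<psi> where \<phi>: "integrable \<mu> \<phi>" and \<psi>: "integrable \<nu> \<psi>"
    and bound: "\<And>x y. x \<le> y \<Longrightarrow> \<bar>g (x, y)\<bar> \<le> \<phi> x + \<psi> y"
    using int by (auto simp: marginal_integrable_def halfplane_def)
  have "sets \<mu> = sets borel" "sets \<nu> = sets borel"
    using PD(4,5) sets_distr by metis+
  then have [measurable]: "\<phi> \<in> borel_measurable borel" "\<psi> \<in> borel_measurable borel"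
    using borel_measurable_integrable[OF \<phi>] borel_measurable_integrable[OF \<psi>] measurable_cong_sets
    by blast+
  have "distr P borel fst = distr Q borel fst" "distr P borel snd = distr Q borel snd"
    using PD QD by auto
  from alternating_chain[OF PD(1,2) QD(1,2) this]
  obtain W :: "(real \<times> (real \<times> real) stream) measure" and T X Y
    where W: "prob_space W" and T[measurable]: "T \<in> measurable W W" and T_distr: "distr W W T = W"
      and X[measurable]: "X \<in> borel_measurable W" and Y[measurable]: "Y \<in> borel_measurable W"
      and P_law: "distr W borel (\<lambda>w. (X w, Y w)) = P" and Q_law: "distr W borel (\<lambda>w. (X (T w), Y w)) = Q"
    by blast
  interpret W: prob_space W by fact
  have XY[measurable]: "(\<lambda>w. (X w, Y w)) \<in> measurable W borel" and XTY[measurable]: "(\<lambda>w. (X (T w), Y w)) \<in> measurable W borel"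
    unfolding borel_prod[symmetric] by measurable
  \<comment> \<open>One term of the cyclic comparison: \<open>y\<close> matched with its partner
    under \<open>P\<close>, minus \<open>y\<close> matched with the next \<open>x\<close>, its
    partner under \<open>Q\<close>.\<close>
  define D where "D w = g1 (X w, Y w) - g1 (X (T w), Y w)" for w
  have int1: "integrable W (\<lambda>w. g1 (X w, Y w))" and int2: "integrable W (\<lambda>w. g1 (X (T w), Y w))"
    using integrable_distr[OF XY, of g1] integrable_distr[OF XTY, of g1] intP intQ
    by (simp_all add: P_law Q_law)
  have intD: "integrable W D" unfolding D_def[abs_def] using int1 int2 by simp
  have g1b: "g1 \<in> borel_measurable borel" using g1 unfolding borel_prod .
  have D_eq: "(\<integral>w. D w \<partial>W) = (\<integral>p. g1 p \<partial>P) - (\<integral>p. g1 p \<partial>Q)"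
    unfolding D_def using int1 int2 integral_distr[OF XY g1b] integral_distr[OF XTY g1b]
    by (simp add: P_law Q_law)
  have "AE p in P. p \<in> \<Gamma>"
  proof -
    interpret P: prob_space P by (rule PD(1))
    show ?thesis using \<Gamma>(3) by (intro P.AE_prob_1) (simp add: supported_by_def)
  qed
  then have "AE w in W. (X w, Y w) \<in> \<Gamma>"
    unfolding P_law[symmetric] by (rule AE_distrD[OF XY])
  moreover have "AE w in W. (X (T w), Y w) \<in> halfplane"
    using QD(6) unfolding Q_law[symmetric] by (rule AE_distrD[OF XTY])
  ultimately have "AE w in W. (X w, Y w) \<in> \<Gamma> \<and> X (T w) \<le> Y w"
    by eventually_elim (auto simp: halfplane_def)
  from AE_funpow[OF T T_distr this]
  have chain: "AE w in W. \<forall>n. (X ((T ^^ n) w), Y ((T ^^ n) w)) \<in> \<Gamma> \<and> X (T ((T ^^ n) w)) \<le> Y ((T ^^ n) w)" .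
  \<comment> \<open>One function makes three properties recur together. Its positive values encode a
    large \<open>Y\<close> through an increasing function, and the value 0 marks states where a cost
    bound \<open>K\<close> fails. As \<open>arctan + 2\<close> is positive, a return above a
    positive value brings all three.\<close>
  define Z where "Z K w = (if \<phi> (X (T w)) \<le> real K \<and> \<psi> (Y w) \<le> real K then arctan (Y w) + 2 else 0)" for K :: nat and w
  have arctan_pos: "0 < arctan t + 2" for t
    using arctan_lbound[of t] pi_less_4 by linarith
  have "AE w in W. \<forall>n. \<exists>j\<ge>n. Z K w \<le> Z K ((T ^^ j) w)" for K
    by (rule stationary_recurrence[OF _ T T_distr]) (unfold_locales, unfold Z_def, measurable)
  then have recur: "AE w in W. \<forall>K n. \<exists>j\<ge>n. Z K w \<le> Z K ((T ^^ j) w)"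
    by (simp add: AE_all_countable)
  \<comment> \<open>Closing a cycle costs a bounded amount but has no favourable sign. A surplus
    \<open>e\<close> per step outweighs it on long cycles, and \<open>e\<close> is sent to 0 at the
    end.\<close>
  have pos: "0 \<le> (\<integral>w. D w \<partial>W) + e" if "0 < e" for e
  proof -
    have "AE w in W. \<exists>n. 0 < (\<Sum>i<n. D ((T ^^ i) w) + e)"
      using chain recur
    proof eventually_elim
      case (elim w)
      define x y where "x i = X ((T ^^ i) w)" and "y i = Y ((T ^^ i) w)" for i
      have xy: "(x i, y i) \<in> \<Gamma>" "x (Suc i) \<le> y i" for i
        using elim(1) unfolding x_def y_def by auto
      have x_le_y: "x i \<le> y i" for i using xy(1)[of i] \<Gamma>(1) by (auto simp: halfplane_def)
      obtain K :: nat where "max (\<phi> (x 1)) (\<psi> (y 0)) \<le> real K" using real_arch_simple by blast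
      then have Zpos: "Z K w = arctan (y 0) + 2" by (auto simp: Z_def x_def y_def)
      \<comment> \<open>The closing term \<open>g (x 0, y j)\<close> costs at most
        \<open>\<phi> (x 0) + \<psi> (y j)\<close>, the dropped term
        \<open>g (x (Suc j), y j)\<close> at most \<open>\<phi> (x (Suc j)) + \<psi> (y j)\<close>.
        All summands but the first are bounded by \<open>K\<close>, hence three times
        \<open>K\<close>.\<close>
      obtain N :: nat where N: "(\<phi> (x 0) + 3 * real K) / e < real N" using reals_Archimedean2 by blast
      obtain j where j: "j \<ge> N" "Z K w \<le> Z K ((T ^^ j) w)" using elim(2) by blast
      have Zj: "\<phi> (x (Suc j)) \<le> real K" "\<psi> (y j) \<le> real K" "y 0 \<le> y j"
        using j(2) arctan_pos[of "y 0"] unfolding Zpos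
        by (auto simp: Z_def x_def y_def arctan_le_iff split: if_splits)
      have D_i: "D ((T ^^ i) w) = g (x i, y i) - g (x (Suc i), y i)" for i
        using x_le_y[of i] xy(2)[of i] by (simp add: D_def g1_def x_def y_def halfplane_def)
      \<comment> \<open>The cycle is closed by matching \<open>y j\<close> with \<open>x 0\<close>,
        which is admissible since \<open>x 0 \<le> y 0 \<le> y j\<close>.\<close>
      define \<sigma> where "\<sigma> i = (if i = j then 0 else Suc i)" for i
      have bij: "bij_betw \<sigma> {..j} {..j}"
      proof (rule bij_betw_imageI)
        show "inj_on \<sigma> {..j}" by (auto simp: inj_on_def \<sigma>_def split: if_splits)
        then show "\<sigma> ` {..j} = {..j}"
          by (intro endo_inj_surj) (auto simp: \<sigma>_def)
      qed
      have "(\<Sum>i\<le>j. g (x (\<sigma> i), y i)) \<le> (\<Sum>i\<le>j. g (x i, y i))"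
      proof (rule noncrossing_sum_le[where g=g, OF _ bij _ _ \<Gamma>(1,2) sub'])
        show "x (\<sigma> i) \<le> y i" for i
          using xy(2)[of i] x_le_y[of 0] Zj(3) by (auto simp: \<sigma>_def)
      qed (use xy in auto)
      moreover have "(\<Sum>i\<le>j. g (x (\<sigma> i), y i)) = (\<Sum>i<j. g (x (Suc i), y i)) + g (x 0, y j)"
        unfolding lessThan_Suc_atMost[symmetric] sum.lessThan_Suc by (auto simp: \<sigma>_def intro!: sum.cong)
      moreover
      have "(\<Sum>i<Suc j. D ((T ^^ i) w) + e) =
          (\<Sum>i\<le>j. g (x i, y i)) - ((\<Sum>i<j. g (x (Suc i), y i)) + g (x (Suc j), y j)) + real (Suc j) * e"
        unfolding D_i by (simp add: sum.distrib sum_subtractf lessThan_Suc_atMost[symmetric] algebra_simps)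
      moreover have "- (\<phi> (x 0) + \<psi> (y j)) \<le> g (x 0, y j)"
        using bound[of "x 0" "y j"] x_le_y[of 0] Zj(3) by auto
      moreover have "g (x (Suc j), y j) \<le> \<phi> (x (Suc j)) + \<psi> (y j)"
        using bound[OF xy(2)[of j]] by auto
      moreover have "\<phi> (x 0) + 3 * real K < real (Suc j) * e"
      proof -
        have "\<phi> (x 0) + 3 * real K < real N * e" using N that by (simp add: divide_simps)
        also have "\<dots> \<le> real (Suc j) * e" using j(1) that by (intro mult_right_mono) auto
        finally show ?thesis .
      qed
      ultimately have "0 < (\<Sum>i<Suc j. D ((T ^^ i) w) + e)" using Zj(1,2) by linarith
      then show ?case by blast
    qed
    then have "0 \<le> (\<integral>w. D w + e \<partial>W)"
      using intD by (intro maximal_ergodic[OF T T_distr]) auto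
    then show ?thesis using intD by (simp add: W.prob_space)
  qed
  have "0 \<le> (\<integral>w. D w \<partial>W)"
    using pos by (rule field_le_epsilon)
  then show ?thesis unfolding D_eq by (simp add: set_lebesgue_integral_def g1_def[abs_def])
qed

section \<open>Exchanging improvable pairs\<close>

lemma improvable_measurable [measurable]: "Measurable.pred (borel \<Otimes>\<^sub>M borel) (\<lambda>(p, q). improvable p q)"
proof -
  have [measurable]: "(fst :: real \<times> real \<Rightarrow> real) \<in> borel_measurable borel"
    "(snd :: real \<times> real \<Rightarrow> real) \<in> borel_measurable borel"
    using measurable_fst_snd_borel[OF refl] by auto
  show ?thesis unfolding improvable_def case_prod_beta' by measurable
qed

lemma optimal_for_iff:
  "optimal_for \<mu> \<nu> g P \<longleftrightarrow> P \<in> directional_couplings \<mu> \<nu> \<and>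
    (\<forall>Q \<in> directional_couplings \<mu> \<nu>. (LINT p:halfplane|Q. g p) \<le> (LINT p:halfplane|P. g p))"
proof (intro iffI conjI ballI)
  assume opt: "optimal_for \<mu> \<nu> g P"
  then show "P \<in> directional_couplings \<mu> \<nu>" by (simp add: optimal_for_def)
  fix Q assume "Q \<in> directional_couplings \<mu> \<nu>"
  then have "ereal (LINT p:halfplane|Q. g p) \<le> (SUP Q \<in> directional_couplings \<mu> \<nu>. ereal (LINT p:halfplane|Q. g p))"
    by (rule SUP_upper)
  also have "\<dots> = ereal (LINT p:halfplane|P. g p)" using opt by (simp add: optimal_for_def)
  finally show "(LINT p:halfplane|Q. g p) \<le> (LINT p:halfplane|P. g p)" by simp
next
  assume *: "P \<in> directional_couplings \<mu> \<nu> \<and>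
    (\<forall>Q \<in> directional_couplings \<mu> \<nu>. (LINT p:halfplane|Q. g p) \<le> (LINT p:halfplane|P. g p))"
  then have "ereal (LINT p:halfplane|P. g p) = (SUP Q \<in> directional_couplings \<mu> \<nu>. ereal (LINT p:halfplane|Q. g p))"
    by (intro antisym SUP_upper SUP_least) auto
  with * show "optimal_for \<mu> \<nu> g P" by (simp add: optimal_for_def)
qed

lemma distr_pair_snd:
  assumes "prob_space M" "sigma_finite_measure N"
  shows "distr (M \<Otimes>\<^sub>M N) N snd = N"
proof (rule measure_eqI)
  interpret M: prob_space M by fact
  interpret N: sigma_finite_measure N by fact
  fix A assume "A \<in> sets (distr (M \<Otimes>\<^sub>M N) N snd)"
  then have A: "A \<in> sets N" by simp
  have "emeasure (distr (M \<Otimes>\<^sub>M N) N snd) A = emeasure (M \<Otimes>\<^sub>M N) (space M \<times> A)"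
    using A sets.sets_into_space[OF A]
    by (subst emeasure_distr) (auto simp: space_pair_measure intro!: arg_cong[where f="emeasure (M \<Otimes>\<^sub>M N)"])
  then show "emeasure (distr (M \<Otimes>\<^sub>M N) N snd) A = emeasure N A"
    using A by (simp add: N.emeasure_pair_measure_Times M.emeasure_space_1)
qed simp

text \<open>Sample two independent pairs from \<^term>\<open>P\<close>, exchange their second coordinates if the pairs are
  improvable, and pick one of the resulting two pairs by a fair coin. This keeps the marginals, and
  it increases the reward strictly unless improvable pairs are negligible.\<close>

lemma optimal_strictly_submodular_imp_AE_not_improvable:
  assumes P: "P \<in> directional_couplings \<mu> \<nu>" and int: "marginal_integrable \<mu> \<nu> g"
    and sub: "strictly_submodular g" and opt: "optimal_for \<mu> \<nu> g P"
  shows "AE (p, q) in P \<Otimes>\<^sub>M P. \<not> improvable p q"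
proof -
  note PD = directional_couplingsD[OF P]
  interpret P: prob_space P by (rule PD(1))
  interpret PP: pair_prob_space P P ..
  define C where "C = measure_pmf (bernoulli_pmf (1 / 2))"
  interpret C: prob_space C unfolding C_def by unfold_locales
  define R where "R = (P \<Otimes>\<^sub>M P) \<Otimes>\<^sub>M C"
  interpret R: pair_prob_space "P \<Otimes>\<^sub>M P" C ..
  have P_sets[measurable_cong]: "sets P = sets (borel \<Otimes>\<^sub>M borel)" using PD(2) by (simp only: borel_prod)
  have P_sets': "sets P = sets borel" by (rule PD(2))
  have C_sets[measurable_cong]: "sets C = sets (count_space UNIV)" by (simp add: C_def)
  have [measurable]: "Measurable.pred (P \<Otimes>\<^sub>M P) (\<lambda>r. improvable (fst r) (snd r))"
    using improvable_measurable
    by (simp only: case_prod_beta' measurable_cong_sets[OF sets_pair_measure_cong[OF P_sets' P_sets'] refl])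
  \<comment> \<open>The coin decides whose first coordinate is kept. The exchange is made for only
    one orientation of the pair; whether or not it happens, the two outcomes of the coin use both
    first and both second coordinates once.\<close>
  define sw :: "(real \<times> real) \<times> (real \<times> real) \<Rightarrow> bool \<Rightarrow> real \<times> real" where
    "sw r c = (let p = fst r; q = snd r in if c
       then (fst p, snd (if improvable p q then q else p))
       else (fst q, snd (if improvable p q then p else q)))" for r c
  have sw[measurable]: "(\<lambda>(r, c). sw r c) \<in> R \<rightarrow>\<^sub>M borel \<Otimes>\<^sub>M borel"
    unfolding sw_def Let_def R_def by measurable
  have int_R: "(\<integral>\<^sup>+z. F z \<partial>R) = (\<integral>\<^sup>+p. \<integral>\<^sup>+q. (F ((p, q), True) + F ((p, q), False)) / 2 \<partial>P \<partial>P)"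
    if [measurable]: "F \<in> borel_measurable R" for F :: "_ \<Rightarrow> ennreal"
  proof -
    have [measurable]: "F \<in> borel_measurable ((P \<Otimes>\<^sub>M P) \<Otimes>\<^sub>M C)" using that by (simp add: R_def)
    have "(\<integral>\<^sup>+z. F z \<partial>R) = (\<integral>\<^sup>+r. \<integral>\<^sup>+c. F (r, c) \<partial>C \<partial>(P \<Otimes>\<^sub>M P))"
      unfolding R_def by (rule C.nn_integral_fst[symmetric]) measurable
    also have "\<dots> = (\<integral>\<^sup>+p. \<integral>\<^sup>+q. \<integral>\<^sup>+c. F ((p, q), c) \<partial>C \<partial>P \<partial>P)"
      by (rule P.nn_integral_fst[symmetric]) measurable
    also have "(\<lambda>p. \<integral>\<^sup>+q. \<integral>\<^sup>+c. F ((p, q), c) \<partial>C \<partial>P) = (\<lambda>p. \<integral>\<^sup>+q. (F ((p, q), True) + F ((p, q), False)) / 2 \<partial>P)"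
      unfolding C_def by (simp add: nn_integral_bernoulli_pmf divide_ennreal_def distrib_right)
    finally show ?thesis .
  qed
  have sym_int: "(\<integral>\<^sup>+p. \<integral>\<^sup>+q. (a p + a q) / 2 \<partial>P \<partial>P) = (\<integral>\<^sup>+p. a p \<partial>P)"
    if [measurable]: "a \<in> borel_measurable P" for a :: "real \<times> real \<Rightarrow> ennreal"
  proof -
    have "(\<integral>\<^sup>+p. \<integral>\<^sup>+q. (a p + a q) / 2 \<partial>P \<partial>P) = ((\<integral>\<^sup>+p. a p \<partial>P) + (\<integral>\<^sup>+p. a p \<partial>P)) / 2"
      by (simp add: nn_integral_divide nn_integral_add P.emeasure_space_1)
    also have "\<dots> = (\<integral>\<^sup>+p. a p \<partial>P)"
      by (simp only: mult_2_right[symmetric]) (rule ennreal_mult_divide_eq, simp_all)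
    finally show ?thesis .
  qed
  define P' where "P' = distr R borel (\<lambda>(r, c). sw r c)"
  have sw_borel[measurable]: "(\<lambda>(r, c). sw r c) \<in> R \<rightarrow>\<^sub>M borel" using sw unfolding borel_prod .
  have P'_int: "(\<integral>\<^sup>+z. F z \<partial>P') = (\<integral>\<^sup>+p. \<integral>\<^sup>+q. (F (sw (p, q) True) + F (sw (p, q) False)) / 2 \<partial>P \<partial>P)"
    if F[measurable]: "F \<in> borel_measurable borel" for F :: "_ \<Rightarrow> ennreal"
  proof -
    have "(\<integral>\<^sup>+z. F z \<partial>P') = (\<integral>\<^sup>+z. F ((\<lambda>(r, c). sw r c) z) \<partial>R)"
      unfolding P'_def by (rule nn_integral_distr) measurable
    also have "\<dots> = (\<integral>\<^sup>+p. \<integral>\<^sup>+q. (F (sw (p, q) True) + F (sw (p, q) False)) / 2 \<partial>P \<partial>P)"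
      using measurable_compose[OF sw_borel F] by (subst int_R) auto
    finally show ?thesis .
  qed
  note fs[measurable] = measurable_fst_snd_borel[OF refl]
  have fsP[measurable]: "fst \<in> borel_measurable P" "snd \<in> borel_measurable P"
    using measurable_fst_snd_borel[OF PD(2)] by auto
  have fsP'[measurable]: "fst \<in> borel_measurable P'" "snd \<in> borel_measurable P'"
    unfolding P'_def by auto
  have P': "P' \<in> directional_couplings \<mu> \<nu>"
    unfolding directional_couplings_def
  proof (intro CollectI conjI)
    show pr: "prob_space P'" unfolding P'_def R_def[symmetric]
      by (rule prob_space.prob_space_distr[OF _ sw_borel]) (unfold R_def, unfold_locales)
    show "sets P' = sets borel" by (simp add: P'_def)
    show "distr P' borel fst = \<mu>"
    proof (rule measure_eqI_indicator)
      show "sets (distr P' borel fst) = sets \<mu>" using PD(4) by auto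
      fix E assume "E \<in> sets (distr P' borel fst)"
      then have [measurable]: "E \<in> sets borel" by simp
      have F: "(\<lambda>z. indicator E (fst z)) \<in> borel_measurable (borel :: (real \<times> real) measure)" by measurable
      have "(\<integral>\<^sup>+w. indicator E w \<partial>distr P' borel fst) = (\<integral>\<^sup>+z. indicator E (fst z) \<partial>P')"
        by (rule nn_integral_distr) measurable
      also have "\<dots> = (\<integral>\<^sup>+p. \<integral>\<^sup>+q. (indicator E (fst p) + indicator E (fst q)) / 2 \<partial>P \<partial>P)"
        unfolding P'_int[OF F] by (simp add: sw_def)
      also have "\<dots> = (\<integral>\<^sup>+p. indicator E (fst p) \<partial>P)" by (rule sym_int) measurable
      also have "\<dots> = (\<integral>\<^sup>+w. indicator E w \<partial>\<mu>)"
        unfolding PD(4)[symmetric] by (rule nn_integral_distr[symmetric]) measurable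
      finally show "(\<integral>\<^sup>+w. indicator E w \<partial>distr P' borel fst) = (\<integral>\<^sup>+w. indicator E w \<partial>\<mu>)" .
    qed
    show "distr P' borel snd = \<nu>"
    proof (rule measure_eqI_indicator)
      show "sets (distr P' borel snd) = sets \<nu>" using PD(5) by auto
      fix E assume "E \<in> sets (distr P' borel snd)"
      then have [measurable]: "E \<in> sets borel" by simp
      have "indicator E (snd (sw (p, q) True)) + indicator E (snd (sw (p, q) False))
          = (indicator E (snd p) + indicator E (snd q) :: ennreal)" for p q
        by (simp add: sw_def add.commute)
      note swap = this
      have F: "(\<lambda>z. indicator E (snd z)) \<in> borel_measurable (borel :: (real \<times> real) measure)" by measurable
      have "(\<integral>\<^sup>+w. indicator E w \<partial>distr P' borel snd) = (\<integral>\<^sup>+z. indicator E (snd z) \<partial>P')"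
        by (rule nn_integral_distr) measurable
      also have "\<dots> = (\<integral>\<^sup>+p. \<integral>\<^sup>+q. (indicator E (snd p) + indicator E (snd q)) / 2 \<partial>P \<partial>P)"
        unfolding P'_int[OF F] swap ..
      also have "\<dots> = (\<integral>\<^sup>+p. indicator E (snd p) \<partial>P)" by (rule sym_int) measurable
      also have "\<dots> = (\<integral>\<^sup>+w. indicator E w \<partial>\<nu>)"
        unfolding PD(5)[symmetric] by (rule nn_integral_distr[symmetric]) measurable
      finally show "(\<integral>\<^sup>+w. indicator E w \<partial>distr P' borel snd) = (\<integral>\<^sup>+w. indicator E w \<partial>\<nu>)" .
    qed
    have ind: "(\<lambda>p. indicator halfplane p) \<in> borel_measurable P"
      unfolding measurable_cong_sets[OF PD(2) refl] by measurable
    have H: "1 = emeasure P halfplane"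
      using PD(6) by (subst P.emeasure_eq_1_AE) (auto simp: PD(2))
    also have "\<dots> = (\<integral>\<^sup>+p. \<integral>\<^sup>+q. (indicator halfplane p + indicator halfplane q) / 2 \<partial>P \<partial>P)"
      using sym_int[OF ind] by (simp add: PD(2))
    \<comment> \<open>Exchanging an improvable pair gives \<open>(x, y')\<close> and
      \<open>(x', y)\<close>; the second stays in \<open>halfplane\<close> because improvability
      includes \<open>x' \<le> y\<close>.\<close>
    also have "\<dots> \<le> (\<integral>\<^sup>+p. \<integral>\<^sup>+q. (indicator halfplane (sw (p, q) True) + indicator halfplane (sw (p, q) False)) / 2 \<partial>P \<partial>P)"
      by (intro nn_integral_mono divide_right_mono_ennreal)
        (auto simp: sw_def improvable_def halfplane_def Let_def split: split_indicator)
    also have "\<dots> = emeasure P' halfplane"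
      by (subst P'_int[symmetric]) (auto simp: P'_def)
    finally show "measure P' halfplane = 1"
      using pr by (simp add: prob_space.measure_ge_1_iff measure_def prob_space.emeasure_ge_1_iff)
  qed
  define g1 where "g1 p = indicator halfplane p *\<^sub>R g p" for p
  have meas: "g \<in> borel_measurable (restrict_space borel halfplane)"
    and sub': "\<And>x x' y y'. x < x' \<Longrightarrow> x' \<le> y \<Longrightarrow> y < y' \<Longrightarrow> g (x, y) + g (x', y') < g (x, y') + g (x', y)"
    using sub by (auto simp: strictly_submodular_def)
  have g1: "g1 \<in> borel_measurable borel"
    using reward_borel[OF meas] unfolding g1_def[symmetric] .
  have intP: "integrable P g1" and intP': "integrable P' g1"
    using reward_integrable[OF P int meas] reward_integrable[OF P' int meas] unfolding g1_def[abs_def] .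
  have le: "(\<integral>p. g1 p \<partial>P') \<le> (\<integral>p. g1 p \<partial>P)"
    using opt P' unfolding optimal_for_iff g1_def by (auto simp: set_lebesgue_integral_def)
  \<comment> \<open>\<open>h\<close> and \<open>k\<close> average the reward over the coin after and
    before the exchange. Always \<open>k \<le> h\<close>, strictly at improvable pairs, while
    optimality of \<open>P\<close> bounds the integral of \<open>h\<close> by that of
    \<open>k\<close>; so they agree almost everywhere.\<close>
  define h where "h r = (g1 (sw r True) + g1 (sw r False)) / 2" for r
  define k where "k r = (g1 (fst r) + g1 (snd r)) / 2" for r
  have intR: "integrable R (\<lambda>z. g1 ((\<lambda>(r, c). sw r c) z))"
    using intP' unfolding P'_def by (rule integrable_distr[OF sw_borel])
  then have intR': "integrable ((P \<Otimes>\<^sub>M P) \<Otimes>\<^sub>M C) (\<lambda>(r, c). g1 (sw r c))"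
    unfolding R_def by (simp add: case_prod_beta')
  have h_eq: "(\<integral>c. g1 (sw r c) \<partial>C) = h r" for r
    unfolding C_def h_def by (simp add: integral_bernoulli_pmf field_simps)
  have h_int: "integrable (P \<Otimes>\<^sub>M P) h"
    using R.integrable_fst[OF intR'] by (simp add: h_eq)
  have P'_eq: "(\<integral>p. g1 p \<partial>P') = (\<integral>r. h r \<partial>(P \<Otimes>\<^sub>M P))"
  proof -
    have "(\<integral>p. g1 p \<partial>P') = (\<integral>z. g1 ((\<lambda>(r, c). sw r c) z) \<partial>R)"
      unfolding P'_def by (rule integral_distr[OF sw_borel g1])
    also have "\<dots> = (\<integral>z. (\<lambda>(r, c). g1 (sw r c)) z \<partial>((P \<Otimes>\<^sub>M P) \<Otimes>\<^sub>M C))"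
      unfolding R_def by (simp add: case_prod_beta')
    also have "\<dots> = (\<integral>r. h r \<partial>(P \<Otimes>\<^sub>M P))"
      using R.integral_fst[OF intR'] by (simp add: h_eq)
    finally show ?thesis .
  qed
  have d_fst: "distr (P \<Otimes>\<^sub>M P) P fst = P" by (rule P.distr_pair_fst)
  have d_snd: "distr (P \<Otimes>\<^sub>M P) P snd = P" by (rule distr_pair_snd) unfold_locales
  have fst_int: "integrable (P \<Otimes>\<^sub>M P) (\<lambda>r. g1 (fst r))"
    using intP by (intro integrable_distr[OF measurable_fst]) (simp only: d_fst)
  have snd_int: "integrable (P \<Otimes>\<^sub>M P) (\<lambda>r. g1 (snd r))"
    using intP by (intro integrable_distr[OF measurable_snd]) (simp only: d_snd)
  have g1P: "g1 \<in> borel_measurable P" using intP by simp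
  have "(\<integral>r. g1 (fst r) \<partial>(P \<Otimes>\<^sub>M P)) = (\<integral>p. g1 p \<partial>P)"
    using integral_distr[OF measurable_fst g1P, of P] by (simp only: d_fst)
  moreover have "(\<integral>r. g1 (snd r) \<partial>(P \<Otimes>\<^sub>M P)) = (\<integral>p. g1 p \<partial>P)"
    using integral_distr[OF measurable_snd g1P, of P] by (simp only: d_snd)
  ultimately have P_eq: "(\<integral>p. g1 p \<partial>P) = (\<integral>r. k r \<partial>(P \<Otimes>\<^sub>M P))" and k_int: "integrable (P \<Otimes>\<^sub>M P) k"
    unfolding k_def[abs_def] using fst_int snd_int by simp_all
  have strict: "k r < h r" if "improvable (fst r) (snd r)" for r
    using sub'[of "fst (fst r)" "fst (snd r)" "snd (fst r)" "snd (snd r)"] that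
    by (auto simp: k_def h_def sw_def g1_def improvable_def halfplane_def Let_def)
  have eq: "k r = h r" if "\<not> improvable (fst r) (snd r)" for r
    using that by (simp add: k_def h_def sw_def)
  have nonneg: "0 \<le> h r - k r" for r using strict[of r] eq[of r] by linarith
  have "(\<integral>r. h r - k r \<partial>(P \<Otimes>\<^sub>M P)) = 0"
  proof (rule antisym)
    show "(\<integral>r. h r - k r \<partial>(P \<Otimes>\<^sub>M P)) \<le> 0" using le h_int k_int by (simp add: P_eq P'_eq)
  qed (use nonneg in simp)
  then have "AE r in P \<Otimes>\<^sub>M P. h r - k r = 0"
    using h_int k_int nonneg by (subst (asm) integral_nonneg_eq_0_iff_AE) auto
  then show ?thesis
    by eventually_elim (use strict in \<open>force simp: case_prod_beta'\<close>)
qed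

section \<open>The pointwise least cdf\<close>

definition gap :: "real measure \<Rightarrow> real measure \<Rightarrow> real \<Rightarrow> real" where
  "gap \<mu> \<nu> z = cdf \<mu> z - cdf \<nu> z"

text \<open>For \<open>y < x\<close> no directional coupling has mass in
  \<open>{x<..} \<times> {..y}\<close>, so its cdf is forced to be the marginal one. The two
  branches agree on the diagonal.\<close>

definition least_cdf :: "real measure \<Rightarrow> real measure \<Rightarrow> real \<Rightarrow> real \<Rightarrow> real" where
  "least_cdf \<mu> \<nu> x y = (if x \<le> y then cdf \<mu> x - (INF z\<in>{x..y}. gap \<mu> \<nu> z) else cdf \<nu> y)"

section \<open>Rectangle masses under a directional coupling\<close>

context
  fixes \<mu> \<nu> :: "real measure" and P :: "(real \<times> real) measure"
  assumes P: "P \<in> directional_couplings \<mu> \<nu>"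
begin

interpretation P: prob_space P by (rule directional_couplingsD(1)[OF P])

lemma rectangle_sets: "A \<in> sets borel \<Longrightarrow> B \<in> sets borel \<Longrightarrow> A \<times> B \<in> sets P"
  by (simp add: directional_couplingsD(2)[OF P] borel_prod[symmetric])

lemma coupling_real_distribution: "real_distribution \<mu>" "real_distribution \<nu>"
  using P.real_distribution_distr[of fst] P.real_distribution_distr[of snd]
    measurable_fst_snd_borel[OF directional_couplingsD(2)[OF P]]
  by (simp_all add: directional_couplingsD[OF P])

lemma coupling_fst: "A \<in> sets borel \<Longrightarrow> measure P (A \<times> UNIV) = measure \<mu> A"
  unfolding directional_couplingsD(4)[OF P, symmetric]
  using measurable_fst_snd_borel[OF directional_couplingsD(2)[OF P]] directional_couplingsD(3)[OF P]
  by (subst measure_distr) (auto intro!: arg_cong[where f="measure P"])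

lemma coupling_snd: "A \<in> sets borel \<Longrightarrow> measure P (UNIV \<times> A) = measure \<nu> A"
  unfolding directional_couplingsD(5)[OF P, symmetric]
  using measurable_fst_snd_borel[OF directional_couplingsD(2)[OF P]] directional_couplingsD(3)[OF P]
  by (subst measure_distr) (auto intro!: arg_cong[where f="measure P"])

lemma coupling_rectangle_mono:
  assumes "A' \<in> sets borel" "B' \<in> sets borel" "A \<subseteq> A'" "B \<subseteq> B'"
  shows "measure P (A \<times> B) \<le> measure P (A' \<times> B')"
  using assms by (intro P.finite_measure_mono rectangle_sets) auto

lemma coupling_null_rectangle:
  assumes "A \<in> sets borel" "B \<in> sets borel" "AE p in P. p \<notin> A \<times> B"
  shows "measure P (A \<times> B) = 0"
  using assms P.prob_eq_0[OF rectangle_sets] by blast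

lemma coupling_null_below:
  assumes "y \<le> x"
  shows "measure P ({x<..} \<times> {..y}) = 0"
proof -
  have "AE p in P. p \<notin> {x<..} \<times> {..y}"
    using directional_couplingsD(6)[OF P]
    by eventually_elim (use assms in \<open>auto simp: halfplane_def\<close>)
  then show ?thesis by (intro coupling_null_rectangle) auto
qed

lemma coupling_tail: "measure P ({..x} \<times> {y<..}) = cdf \<mu> x - cdf2 P x y"
proof -
  have "measure P ({..x} \<times> UNIV) = measure P ({..x} \<times> {..y}) + measure P ({..x} \<times> {y<..})"
    by (subst P.finite_measure_Union[symmetric])
      (auto intro!: rectangle_sets arg_cong[where f="measure P"])
  then show ?thesis by (simp add: coupling_fst cdf_def cdf2_def)
qed

lemma cdf2_below:
  assumes "y \<le> x"
  shows "cdf2 P x y = cdf \<nu> y"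
proof -
  have "measure P (UNIV \<times> {..y}) = measure P ({..x} \<times> {..y}) + measure P ({x<..} \<times> {..y})"
    by (subst P.finite_measure_Union[symmetric])
      (auto intro!: rectangle_sets arg_cong[where f="measure P"])
  then show ?thesis using assms by (simp add: coupling_snd cdf_def cdf2_def coupling_null_below)
qed

lemma coupling_gap: "measure P ({..z} \<times> {z<..}) = gap \<mu> \<nu> z"
  by (simp add: coupling_tail cdf2_below gap_def)

lemma gap_nonneg: "0 \<le> gap \<mu> \<nu> z"
  by (metis coupling_gap measure_nonneg)

lemma gap_bdd_below: "bdd_below (gap \<mu> \<nu> ` S)"
  using gap_nonneg by (auto intro!: bdd_belowI[where m=0])

lemma coupling_tail_le_gap:
  assumes "x \<le> z" "z \<le> y"
  shows "measure P ({..x} \<times> {y<..}) \<le> gap \<mu> \<nu> z"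
  unfolding coupling_gap[symmetric] using assms by (intro coupling_rectangle_mono) auto

lemma least_cdf_le: "least_cdf \<mu> \<nu> x y \<le> cdf2 P x y"
proof (cases "x \<le> y")
  case True
  have "measure P ({..x} \<times> {y<..}) \<le> (INF z\<in>{x..y}. gap \<mu> \<nu> z)"
    using True coupling_tail_le_gap by (intro cINF_greatest) auto
  then show ?thesis using True by (simp add: least_cdf_def coupling_tail)
qed (simp add: least_cdf_def cdf2_below)

text \<open>The mass crossing \<open>z\<close> consists of the mass jumping over all of
  \<open>[x, y]\<close> and two excess rectangles. The bound is attained at \<open>z\<close> exactly
  when both excesses vanish, which drives both directions of the equivalence with (iv).\<close>

lemma coupling_gap_split:
  assumes "x \<le> z" "z \<le> y"
  shows "gap \<mu> \<nu> z = measure P ({..x} \<times> {y<..}) + measure P ({..x} \<times> {z<..y}) + measure P ({x<..z} \<times> {z<..})"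
proof -
  have "{..z} \<times> {z<..} = ({..x} \<times> {y<..} \<union> {..x} \<times> {z<..y}) \<union> {x<..z} \<times> {z<..}"
    using assms by auto
  moreover have "measure P (({..x} \<times> {y<..} \<union> {..x} \<times> {z<..y}) \<union> {x<..z} \<times> {z<..})
      = measure P ({..x} \<times> {y<..} \<union> {..x} \<times> {z<..y}) + measure P ({x<..z} \<times> {z<..})"
    by (rule P.finite_measure_Union) (auto intro!: rectangle_sets sets.Un)
  moreover have "measure P ({..x} \<times> {y<..} \<union> {..x} \<times> {z<..y}) = measure P ({..x} \<times> {y<..}) + measure P ({..x} \<times> {z<..y})"
    by (rule P.finite_measure_Union) (auto intro!: rectangle_sets)
  ultimately show ?thesis by (simp add: coupling_gap[symmetric])
qed

lemma least_cdf_eqI: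
  assumes "AE (p, q) in P \<Otimes>\<^sub>M P. \<not> improvable p q"
  shows "cdf2 P x y = least_cdf \<mu> \<nu> x y"
proof (cases "x \<le> y")
  case False
  then show ?thesis by (simp add: least_cdf_def cdf2_below)
next
  case True
  interpret PP: pair_prob_space P P ..
  \<comment> \<open>By Fubini almost every point forms an improvable pair with almost no other
    point; these points stand in for a support.\<close>
  define good where "good p \<longleftrightarrow> p \<in> halfplane \<and> (AE q in P. \<not> improvable p q)" for p
  have "AE p in P. AE q in P. \<not> improvable p q"
    using PP.AE_pair[OF assms] by simp
  with directional_couplingsD(6)[OF P] have good: "AE p in P. good p"
    by eventually_elim (simp add: good_def)
  define S where "S = snd ` {p. good p \<and> fst p \<le> x \<and> x < snd p \<and> snd p \<le> y}"
  have null: "measure P ({x<..z} \<times> {z<..}) = 0" if zS: "z \<in> S" for z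
  proof -
    obtain p where "z = snd p" "p \<in> {p. good p \<and> fst p \<le> x \<and> x < snd p \<and> snd p \<le> y}"
      using zS unfolding S_def by (rule imageE)
    then have p: "good p" "fst p \<le> x" "x < z" "snd p = z" by auto
    then have "AE q in P. \<not> improvable p q" by (simp add: good_def)
    with directional_couplingsD(6)[OF P] have "AE q in P. q \<notin> {x<..z} \<times> {z<..}"
      by eventually_elim (use p in \<open>auto simp: improvable_def good_def\<close>)
    then show ?thesis by (intro coupling_null_rectangle) auto
  qed
  \<comment> \<open>Heights in \<open>S\<close> make the right excess vanish, and heights near the
    supremum of \<open>S\<close> make the left one small. If \<open>S\<close> is empty,
    \<open>z = x\<close> serves: its right excess rectangle is empty. Since the supremum need not
    belong to \<open>S\<close>, only approximation is claimed.\<close>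
  have approx: "\<exists>z\<in>{x..y}. gap \<mu> \<nu> z \<le> measure P ({..x} \<times> {y<..}) + e" if "0 < e" for e
  proof (cases "S = {}")
    case True
    have "AE p in P. p \<notin> {..x} \<times> {x<..y}"
      using good by eventually_elim (use True in \<open>auto simp: S_def\<close>)
    then have "measure P ({..x} \<times> {x<..y}) = 0"
      by (intro coupling_null_rectangle) auto
    then show ?thesis
      using coupling_gap_split[of x x y] \<open>x \<le> y\<close> that by (intro bexI[of _ x]) auto
  next
    case False
    define s where "s = Sup S"
    have bdd: "bdd_above S" by (auto simp: S_def intro!: bdd_aboveI[where M=y])
    have S_le: "z \<le> s" if "z \<in> S" for z using cSup_upper[OF that bdd] by (simp add: s_def)
    have S_xy: "x < z" "z \<le> y" if "z \<in> S" for z using that by (auto simp: S_def)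
    have AE_le: "AE p in P. p \<notin> {..x} \<times> {s<..y}"
      using good
    proof eventually_elim
      case (elim p)
      then have "snd p \<in> S" if "fst p \<le> x" "x < snd p" "snd p \<le> y"
        using that by (auto simp: S_def)
      then show ?case using False S_le S_xy(1) by (force simp: not_less)
    qed
    show ?thesis
    proof (cases "s \<in> S")
      case True
      have "measure P ({..x} \<times> {s<..y}) = 0"
        using AE_le by (intro coupling_null_rectangle) auto
      then show ?thesis
        using coupling_gap_split[of x s y] null[OF True] S_xy[OF True] that by (intro bexI[of _ s]) auto
    next
      case sS: False
      \<comment> \<open>As \<open>s\<close> is not in \<open>S\<close>, almost no relevant mass lies
        at height \<open>s\<close> either. What remains above \<open>z\<close> lies in a strip just
        below \<open>s\<close>, and such strips shrink to the empty set.\<close>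
      have AE_ge: "AE p in P. p \<notin> {..x} \<times> {s..y}"
        using good AE_le
      proof eventually_elim
        case (elim p)
        have "x < s" using False S_le S_xy(1) by fastforce
        then have "snd p \<noteq> s \<or> \<not> fst p \<le> x \<or> \<not> s \<le> y"
          using elim(1) sS by (auto simp: S_def image_iff)
        then show ?case using elim(2) by (cases p) auto
      qed
      have "(\<lambda>n. measure P ({..x} \<times> {s - 1 / Suc n<..<s})) \<longlonglongrightarrow> measure P (\<Inter>n. {..x} \<times> {s - 1 / Suc n<..<s})"
      proof (intro P.finite_Lim_measure_decseq decseq_SucI)
        show "{..x} \<times> {s - 1 / Suc (Suc n)<..<s} \<subseteq> {..x} \<times> {s - 1 / Suc n<..<s}" for n
        proof -
          have "1 / real (Suc (Suc n)) \<le> 1 / real (Suc n)" by (simp add: divide_simps)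
          then show ?thesis by auto
        qed
      qed (auto intro: rectangle_sets)
      also have "(\<Inter>n. {..x} \<times> {s - 1 / Suc n<..<s}) = {}"
      proof -
        have False if b: "\<forall>n. s - 1 / Suc n < b" "b < s" for b
        proof -
          obtain n where "1 / real (Suc n) < s - b" using nat_approx_posE[of "s - b"] b(2) by auto
          with b(1)[rule_format, of n] show False by simp
        qed
        then show ?thesis by fastforce
      qed
      finally have "eventually (\<lambda>n. measure P ({..x} \<times> {s - 1 / Suc n<..<s}) < e) sequentially"
        using that by (intro order_tendstoD) auto
      then obtain n where n: "measure P ({..x} \<times> {s - 1 / Suc n<..<s}) < e"
        by (auto simp: eventually_sequentially)
      have "s - 1 / Suc n < Sup S" by (simp add: s_def[symmetric])
      then obtain z where z: "z \<in> S" "s - 1 / Suc n < z" using less_cSup_iff[OF False bdd] by auto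
      have "measure P ({..x} \<times> {z<..y}) \<le> measure P ({..x} \<times> {s - 1 / Suc n<..<s})"
      proof (intro P.finite_measure_mono_AE)
        show "AE p in P. p \<in> {..x} \<times> {z<..y} \<longrightarrow> p \<in> {..x} \<times> {s - 1 / Suc n<..<s}"
          using AE_ge by eventually_elim (use z(2) in \<open>auto simp: not_le\<close>)
      qed (auto intro: rectangle_sets)
      then show ?thesis
        using n coupling_gap_split[of x z y] null[OF z(1)] S_xy[OF z(1)] by (intro bexI[of _ z]) auto
    qed
  qed
  have "(INF z\<in>{x..y}. gap \<mu> \<nu> z) \<le> measure P ({..x} \<times> {y<..})"
  proof (rule field_le_epsilon)
    fix e :: real assume "0 < e"
    from approx[OF this] obtain z where "z \<in> {x..y}" "gap \<mu> \<nu> z \<le> measure P ({..x} \<times> {y<..}) + e" by auto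
    then show "(INF z\<in>{x..y}. gap \<mu> \<nu> z) \<le> measure P ({..x} \<times> {y<..}) + e"
      using gap_bdd_below by (meson cINF_lower order_trans)
  qed
  then have "cdf2 P x y \<le> least_cdf \<mu> \<nu> x y" using True by (simp add: least_cdf_def coupling_tail)
  then show ?thesis using least_cdf_le by (intro antisym)
qed

text \<open>The points \<open>u n\<close> nearly minimise the gap over \<open>[a, b]\<close>. Whether a limit point \<open>z\<close> of them is
  approached from the right or from the left decides on which side of \<open>z\<close> the mass is missing.\<close>

lemma crossing_null_set:
  assumes eq: "cdf2 P a b = least_cdf \<mu> \<nu> a b" and "a \<le> b"
  shows "\<exists>N \<in> sets borel. measure P N = 0 \<and>
    (\<forall>p p'. p \<notin> N \<longrightarrow> p' \<notin> N \<longrightarrow> fst p \<le> a \<longrightarrow> a < fst p' \<longrightarrow> fst p' \<le> snd p \<longrightarrow> snd p \<le> b \<longrightarrow> \<not> b < snd p')"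
proof -
  have tail: "measure P ({..a} \<times> {b<..}) = (INF z\<in>{a..b}. gap \<mu> \<nu> z)"
    using eq \<open>a \<le> b\<close> by (simp add: coupling_tail least_cdf_def)
  have "\<exists>u\<in>{a..b}. gap \<mu> \<nu> u < measure P ({..a} \<times> {b<..}) + 1 / Suc n" for n
    using cInf_lessD[of "gap \<mu> \<nu> ` {a..b}" "measure P ({..a} \<times> {b<..}) + 1 / Suc n"] \<open>a \<le> b\<close>
    unfolding tail by auto
  then obtain u where u: "\<And>n. u n \<in> {a..b}" "\<And>n. gap \<mu> \<nu> (u n) < measure P ({..a} \<times> {b<..}) + 1 / Suc n"
    by metis
  \<comment> \<open>The gap at \<open>u n\<close> exceeds the tail mass by less than
    \<open>1 / Suc n\<close>, and by \<open>coupling_gap_split\<close> this excess is the sum of the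
    two rectangle masses.\<close>
  have small: "measure P ({..a} \<times> {u n<..b}) \<le> 1 / Suc n" "measure P ({a<..u n} \<times> {u n<..}) \<le> 1 / Suc n" for n
  proof -
    have "a \<le> u n" "u n \<le> b" using u(1)[of n] by auto
    then show "measure P ({..a} \<times> {u n<..b}) \<le> 1 / Suc n" "measure P ({a<..u n} \<times> {u n<..}) \<le> 1 / Suc n"
      using coupling_gap_split[of a "u n" b] u(2)[of n]
        measure_nonneg[of P "{..a} \<times> {u n<..b}"] measure_nonneg[of P "{a<..u n} \<times> {u n<..}"] by linarith+
  qed
  have inv_small: "c \<le> 0" if "frequently (\<lambda>n. c \<le> 1 / Suc n) sequentially" for c :: real
  proof (rule ccontr)
    assume "\<not> c \<le> 0"
    moreover have "(\<lambda>n. 1 / Suc n) \<longlonglongrightarrow> (0::real)"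
      using LIMSEQ_inverse_real_of_nat by (simp add: inverse_eq_divide)
    ultimately have "eventually (\<lambda>n. 1 / Suc n < c) sequentially" by (intro order_tendstoD) auto
    with that show False by (simp add: frequently_def not_le)
  qed
  obtain z r where r: "z \<in> {a..b}" "strict_mono (r :: nat \<Rightarrow> nat)" "(u \<circ> r) \<longlonglongrightarrow> z"
    using compact_Icc[of a b] u(1) unfolding compact_def by metis
  have freq: "frequently (\<lambda>n. \<bar>u n - z\<bar> < d) sequentially" if "0 < d" for d
    unfolding frequently_sequentially
  proof
    fix N
    have "eventually (\<lambda>n. \<bar>u (r n) - z\<bar> < d \<and> N \<le> n) sequentially"
      using tendstoD[OF r(3) that] eventually_ge_at_top[of N] by eventually_elim (auto simp: dist_real_def)
    then obtain n where "\<bar>u (r n) - z\<bar> < d" "N \<le> n" by (auto simp: eventually_sequentially)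
    then show "\<exists>n\<ge>N. \<bar>u n - z\<bar> < d"
      using seq_suble[OF r(2), of n] by (intro exI[of _ "r n"]) auto
  qed
  have side: "(\<forall>d>0. frequently (\<lambda>n. z \<le> u n \<and> u n < z + d) sequentially) \<or>
    (\<forall>d>0. frequently (\<lambda>n. z - d < u n \<and> u n < z) sequentially)"
  proof (rule ccontr)
    assume "\<not> ?thesis"
    then obtain d d' where d: "0 < d" "\<not> frequently (\<lambda>n. z \<le> u n \<and> u n < z + d) sequentially"
      and d': "0 < d'" "\<not> frequently (\<lambda>n. z - d' < u n \<and> u n < z) sequentially" by blast
    from d(2) d'(2) have "eventually (\<lambda>n. \<not> \<bar>u n - z\<bar> < min d d') sequentially"
      unfolding not_frequently by eventually_elim auto
    with freq[of "min d d'"] d(1) d'(1) show False by (auto simp: frequently_def)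
  qed
  have limit_null: "measure P (\<Union>k. A k) = 0"
    if "\<And>k. A k \<in> sets P" "\<And>k. measure P (A k) \<le> 0" for A :: "nat \<Rightarrow> (real \<times> real) set"
  proof -
    have "emeasure P (A k) = 0" for k
      using that(2)[of k] by (simp add: P.emeasure_eq_measure measure_le_0_iff)
    then have "emeasure P (\<Union>k. A k) = 0" using that(1) by (intro emeasure_UN_eq_0) auto
    then show ?thesis by (simp add: measure_def)
  qed
  have \<delta>: "\<exists>k. 1 / real (Suc k) < d" if "0 < d" for d
    using nat_approx_posE[OF that] by metis
  from side show ?thesis
  proof
    assume right: "\<forall>d>0. frequently (\<lambda>n. z \<le> u n \<and> u n < z + d) sequentially"
    \<comment> \<open>Infinitely many \<open>u n\<close> lie in the interval from \<open>z\<close>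
      to \<open>z + 1 / Suc k\<close>. The fixed rectangles therefore sit inside rectangles of
      arbitrarily small mass, and their unions reach every height strictly above
      \<open>z\<close>.\<close>
    define A B where "A k = {..a} \<times> {z + 1 / Suc k..b}" and "B k = {a<..z} \<times> {z + 1 / Suc k..}" for k :: nat
    have sets: "A k \<in> sets P" "B k \<in> sets P" for k unfolding A_def B_def by (auto intro: rectangle_sets)
    have freq': "frequently (\<lambda>n. z \<le> u n \<and> u n < z + 1 / Suc k) sequentially" for k
      using right by simp
    have "measure P (A k) \<le> 0" for k
    proof (rule inv_small[OF frequently_mono[OF _ freq'[of k]]], intro allI impI)
      fix n assume "z \<le> u n \<and> u n < z + 1 / Suc k"
      then have "measure P (A k) \<le> measure P ({..a} \<times> {u n<..b})"
        unfolding A_def by (intro coupling_rectangle_mono) auto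
      then show "measure P (A k) \<le> 1 / Suc n" using small(1)[of n] by linarith
    qed
    note A0 = limit_null[of A, OF sets(1) this]
    have "measure P (B k) \<le> 0" for k
    proof (rule inv_small[OF frequently_mono[OF _ freq'[of k]]], intro allI impI)
      fix n assume "z \<le> u n \<and> u n < z + 1 / Suc k"
      then have "measure P (B k) \<le> measure P ({a<..u n} \<times> {u n<..})"
        unfolding B_def by (intro coupling_rectangle_mono) auto
      then show "measure P (B k) \<le> 1 / Suc n" using small(2)[of n] by linarith
    qed
    note B0 = limit_null[of B, OF sets(2) this]
    have memA: "(s, t) \<in> (\<Union>k. A k)" if "s \<le> a" "z < t" "t \<le> b" for s t
      using \<delta>[of "t - z"] that by (auto simp: A_def) (metis add.commute less_diff_eq less_imp_le)
    have memB: "(s, t) \<in> (\<Union>k. B k)" if "a < s" "s \<le> z" "z < t" for s t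
      using \<delta>[of "t - z"] that by (auto simp: B_def) (metis add.commute less_diff_eq less_imp_le)
    show ?thesis
    proof (intro bexI conjI allI impI notI)
      show "(\<Union>k. A k) \<union> (\<Union>k. B k) \<in> sets borel"
        using sets by (auto simp: directional_couplingsD(2)[OF P])
      show "measure P ((\<Union>k. A k) \<union> (\<Union>k. B k)) = 0"
        using sets measure_Un_le[of "\<Union>k. A k" P "\<Union>k. B k"] by (simp add: A0 B0 measure_le_0_iff)
      \<comment> \<open>If \<open>snd p\<close> exceeds \<open>z\<close>, then \<open>p\<close> lies
        in some \<open>A k\<close>. Otherwise
        \<open>fst p' \<le> snd p \<le> z \<le> b < snd p'\<close>, and \<open>p'\<close> lies in
        some \<open>B k\<close>.\<close>
      fix p p' assume "p \<notin> (\<Union>k. A k) \<union> (\<Union>k. B k)" "p' \<notin> (\<Union>k. A k) \<union> (\<Union>k. B k)"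
        and "fst p \<le> a" "a < fst p'" "fst p' \<le> snd p" "snd p \<le> b" "b < snd p'"
      then show False
        using memA[of "fst p" "snd p"] memB[of "fst p'" "snd p'"] r(1)
        by (cases "z < snd p"; cases "fst p' \<le> z") auto
    qed
  next
    assume left: "\<forall>d>0. frequently (\<lambda>n. z - d < u n \<and> u n < z) sequentially"
    \<comment> \<open>Approach from below reverses the boundary cases: height \<open>z\<close>
      itself is now covered, whereas first coordinates must stay strictly below
      \<open>z\<close>.\<close>
    define B where "B k = {a<..z - 1 / Suc k} \<times> {z..}" for k :: nat
    have A_sets: "{..a} \<times> {z..b} \<in> sets P" by (auto intro: rectangle_sets)
    have sets: "B k \<in> sets P" for k unfolding B_def by (auto intro: rectangle_sets)
    have freq': "frequently (\<lambda>n. z - 1 / Suc k < u n \<and> u n < z) sequentially" for k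
      using left by simp
    have "measure P ({..a} \<times> {z..b}) \<le> 0"
    proof (rule inv_small[OF frequently_mono[OF _ freq'[of 0]]], intro allI impI)
      fix n assume "z - 1 / Suc 0 < u n \<and> u n < z"
      then have "measure P ({..a} \<times> {z..b}) \<le> measure P ({..a} \<times> {u n<..b})"
        by (intro coupling_rectangle_mono) auto
      then show "measure P ({..a} \<times> {z..b}) \<le> 1 / Suc n" using small(1)[of n] by linarith
    qed
    note A0 = this
    have "measure P (B k) \<le> 0" for k
    proof (rule inv_small[OF frequently_mono[OF _ freq'[of k]]], intro allI impI)
      fix n assume "z - 1 / Suc k < u n \<and> u n < z"
      then have "measure P (B k) \<le> measure P ({a<..u n} \<times> {u n<..})"
        unfolding B_def by (intro coupling_rectangle_mono) auto
      then show "measure P (B k) \<le> 1 / Suc n" using small(2)[of n] by linarith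
    qed
    note B0 = limit_null[of B, OF sets this]
    have memB: "(s, t) \<in> (\<Union>k. B k)" if "a < s" "s < z" "z \<le> t" for s t
      using \<delta>[of "z - s"] that by (auto simp: B_def) (metis diff_less_eq add.commute le_diff_eq less_imp_le less_diff_eq)
    show ?thesis
    proof (intro bexI conjI allI impI notI)
      show "{..a} \<times> {z..b} \<union> (\<Union>k. B k) \<in> sets borel"
        using A_sets sets by (auto simp: directional_couplingsD(2)[OF P])
      show "measure P ({..a} \<times> {z..b} \<union> (\<Union>k. B k)) = 0"
        using A_sets sets A0 measure_Un_le[of "{..a} \<times> {z..b}" P "\<Union>k. B k"]
        by (simp add: B0 measure_le_0_iff)
      fix p p' assume "p \<notin> {..a} \<times> {z..b} \<union> (\<Union>k. B k)" "p' \<notin> {..a} \<times> {z..b} \<union> (\<Union>k. B k)"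
        and "fst p \<le> a" "a < fst p'" "fst p' \<le> snd p" "snd p \<le> b" "b < snd p'"
      then show False
        using memB[of "fst p'" "snd p'"] r(1) by (cases p) auto
    qed
  qed
qed

text \<open>An improvable pair leaves room for rationals \<open>q\<close> between the first
  coordinates and \<open>r\<close> between the second, with
  \<open>q < fst p' \<le> snd p < r\<close>. Countably many null sets thus catch all such
  pairs.\<close>

lemma least_cdf_imp_noncrossing:
  assumes eq: "\<And>x y. cdf2 P x y = least_cdf \<mu> \<nu> x y"
  obtains \<Gamma> where "\<Gamma> \<subseteq> halfplane" "constrained_crossing \<Gamma>" "supported_by P \<Gamma>"
proof -
  have "\<exists>N \<in> sets borel. measure P N = 0 \<and> (a \<le> b \<longrightarrow>
    (\<forall>p p'. p \<notin> N \<longrightarrow> p' \<notin> N \<longrightarrow> fst p \<le> a \<longrightarrow> a < fst p' \<longrightarrow> fst p' \<le> snd p \<longrightarrow> snd p \<le> b \<longrightarrow> \<not> b < snd p'))" for a b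
    using crossing_null_set[OF eq, of a b] by (cases "a \<le> b") (auto intro!: bexI[of _ "{}"])
  then obtain N where N: "\<And>a b. N a b \<in> sets borel" "\<And>a b. measure P (N a b) = 0"
    "\<And>a b p p'. a \<le> b \<Longrightarrow> p \<notin> N a b \<Longrightarrow> p' \<notin> N a b \<Longrightarrow> fst p \<le> a \<Longrightarrow> a < fst p' \<Longrightarrow>
      fst p' \<le> snd p \<Longrightarrow> snd p \<le> b \<Longrightarrow> \<not> b < snd p'"
    by metis
  define \<Gamma> where "\<Gamma> = halfplane - (\<Union>(q, r). N (real_of_rat q) (real_of_rat r))"
  have \<Gamma>_sets: "\<Gamma> \<in> sets borel" unfolding \<Gamma>_def by (intro sets.Diff sets.countable_UN) (use N(1) in auto)
  have "AE p in P. p \<notin> N a b" for a b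
    using N(1,2)[of a b] by (subst P.prob_eq_0[symmetric]) (auto simp: directional_couplingsD(2)[OF P])
  then have "AE p in P. \<forall>q r :: rat. p \<notin> N (of_rat q) (of_rat r)" by (simp add: AE_all_countable)
  with directional_couplingsD(6)[OF P] have "AE p in P. p \<in> \<Gamma>"
    by eventually_elim (auto simp: \<Gamma>_def)
  then have "measure P \<Gamma> = 1"
    using \<Gamma>_sets by (subst P.prob_eq_1) (auto simp: directional_couplingsD(2)[OF P])
  moreover have "constrained_crossing \<Gamma>"
    unfolding constrained_crossing_def
  proof (intro ballI notI)
    fix p p' assume *: "p \<in> \<Gamma>" "p' \<in> \<Gamma>" and imp: "improvable p p'"
    obtain q where q: "fst p < of_rat q" "of_rat q < fst p'"
      using of_rat_dense imp by (auto simp: improvable_def)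
    obtain r where r: "snd p < of_rat r" "of_rat r < snd p'"
      using of_rat_dense imp by (auto simp: improvable_def)
    show False
      using N(3)[of "of_rat q" "of_rat r" p p'] * q r imp by (auto simp: \<Gamma>_def improvable_def)
  qed
  moreover have "\<Gamma> \<subseteq> halfplane" by (auto simp: \<Gamma>_def)
  ultimately show thesis using that[of \<Gamma>] \<Gamma>_sets by (simp add: supported_by_def)
qed

end

lemma noncrossing_imp_AE_not_improvable:
  assumes P: "P \<in> directional_couplings \<mu> \<nu>"
    and \<Gamma>: "constrained_crossing \<Gamma>" "supported_by P \<Gamma>"
  shows "AE (p, q) in P \<Otimes>\<^sub>M P. \<not> improvable p q"
proof -
  interpret P: prob_space P by (rule directional_couplingsD(1)[OF P])
  have supp: "AE p in P. p \<in> \<Gamma>" using \<Gamma>(2) by (intro P.AE_prob_1) (simp add: supported_by_def)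
  have "AE p in distr (P \<Otimes>\<^sub>M P) P fst. p \<in> \<Gamma>" "AE p in distr (P \<Otimes>\<^sub>M P) P snd. p \<in> \<Gamma>"
    unfolding P.distr_pair_fst distr_pair_snd[OF P.prob_space_axioms P.sigma_finite_measure_axioms] by (rule supp)+
  then have "AE r in P \<Otimes>\<^sub>M P. fst r \<in> \<Gamma>" "AE r in P \<Otimes>\<^sub>M P. snd r \<in> \<Gamma>"
    by (auto dest: AE_distrD[OF measurable_fst] AE_distrD[OF measurable_snd])
  then show ?thesis by eventually_elim (use \<Gamma>(1) in \<open>auto simp: constrained_crossing_def\<close>)
qed

section \<open>Existence of the least coupling\<close>

lemma mono_tendsto_0_nonneg:
  fixes F :: "real \<Rightarrow> real"
  assumes "\<And>x y. x \<le> y \<Longrightarrow> F x \<le> F y" "(F \<longlongrightarrow> 0) at_bot"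
  shows "0 \<le> F x"
  using assms(2) by (rule tendsto_upperbound)
    (auto simp: eventually_at_bot_linorder assms(1) intro!: exI[of _ x])

text \<open>\<open>F2 - F1\<close> is itself a distribution function, and its measure added to that
  of \<open>F1\<close> has the cdf of \<open>F2\<close>; uniqueness of cdfs extends the comparison
  from half-lines to all sets.\<close>

lemma interval_measure_dominated:
  assumes F1: "\<And>x y. x \<le> y \<Longrightarrow> F1 x \<le> F1 y" "\<And>a. continuous (at_right a) F1"
      "(F1 \<longlongrightarrow> 0) at_bot" "(F1 \<longlongrightarrow> m1) at_top"
    and D: "\<And>x y. x \<le> y \<Longrightarrow> F2 x - F1 x \<le> F2 y - F1 y"
    and F2: "\<And>a. continuous (at_right a) F2" "(F2 \<longlongrightarrow> 0) at_bot" "(F2 \<longlongrightarrow> m2) at_top"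
  shows "emeasure (interval_measure F1) A \<le> emeasure (interval_measure F2) A"
proof (cases "A \<in> sets borel")
  case True
  define M1 M2 L where "M1 = interval_measure F1" and "M2 = interval_measure F2"
    and "L = interval_measure (\<lambda>x. F2 x - F1 x)"
  have F2_mono: "F2 x \<le> F2 y" if "x \<le> y" for x y using F1(1)[OF that] D[OF that] by linarith
  have D_lim: "continuous (at_right a) (\<lambda>x. F2 x - F1 x)" "((\<lambda>x. F2 x - F1 x) \<longlongrightarrow> 0) at_bot" for a
    using F1(2) F2(1) tendsto_diff[OF F2(2) F1(3)] by (auto intro: continuous_diff)
  have m: "0 \<le> m1" "0 \<le> m2"
    using tendsto_lowerbound[OF F1(4), of 0] tendsto_lowerbound[OF F2(3), of 0]
      mono_tendsto_0_nonneg[OF F1(1,3)] mono_tendsto_0_nonneg[OF F2_mono F2(2)] by auto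
  define S where "S = measure_of UNIV (sets borel) (\<lambda>A. emeasure M1 A + emeasure L A)"
  have S_sets: "sets S = sets borel" "space S = UNIV"
    using sets.sigma_sets_eq[of "borel :: real measure"] by (simp_all add: S_def)
  have S: "emeasure S A = emeasure M1 A + emeasure L A" if "A \<in> sets borel" for A
  proof (rule emeasure_measure_of[OF S_def])
    show "countably_additive (sets S) (\<lambda>A. emeasure M1 A + emeasure L A)"
    proof (rule countably_additiveI)
      fix B :: "nat \<Rightarrow> real set" assume B: "range B \<subseteq> sets S" "disjoint_family B"
      then have B': "range B \<subseteq> sets borel" by (simp add: S_sets)
      show "(\<Sum>i. emeasure M1 (B i) + emeasure L (B i)) = emeasure M1 (\<Union>i. B i) + emeasure L (\<Union>i. B i)"
        using B B' by (subst suminf_add[symmetric]) (auto simp: suminf_emeasure M1_def L_def)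
    qed
  qed (use that in \<open>auto simp: positive_def S_sets\<close>)
  have fin: "finite_borel_measure M1" "finite_borel_measure M2" "finite_borel_measure L"
    unfolding M1_def M2_def L_def
    using m tendsto_diff[OF F2(3) F1(4)] tendsto_lowerbound[OF tendsto_diff[OF F2(3) F1(4)], of 0]
      mono_tendsto_0_nonneg[OF D D_lim(2)] F1 F2 F2_mono D D_lim
    by (auto intro!: finite_borel_measure_interval_measure)
  have "finite_borel_measure S"
  proof -
    have "emeasure S (space S) \<noteq> \<infinity>"
      using fin by (simp add: S S_sets finite_borel_measure_def finite_measure.emeasure_eq_measure)
    then show ?thesis
      using S_sets by (auto simp: finite_borel_measure_def finite_borel_measure_axioms_def intro!: finite_measureI)
  qed
  moreover have "cdf S = cdf M2"
  proof
    fix x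
    have "0 \<le> F1 x" "0 \<le> F2 x - F1 x" "0 \<le> F2 x"
      using mono_tendsto_0_nonneg[OF F1(1,3)] mono_tendsto_0_nonneg[OF D D_lim(2)]
        mono_tendsto_0_nonneg[OF F2_mono F2(2)] by auto
    moreover have "emeasure M1 {..x} = ennreal (F1 x)" "emeasure M2 {..x} = ennreal (F2 x)" "emeasure L {..x} = ennreal (F2 x - F1 x)"
      unfolding M1_def M2_def L_def
      by (intro emeasure_interval_measure_Iic F1 F2 D D_lim F2_mono; assumption)+
    ultimately show "cdf S x = cdf M2 x"
      by (simp add: cdf_def measure_def S flip: ennreal_plus)
  qed
  ultimately have "S = M2" using fin(2) by (intro cdf_unique')
  then show ?thesis using S[OF True] unfolding M1_def M2_def by (metis le_iff_add)
qed (simp add: emeasure_notin_sets)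

lemma continuous_at_right_iff_eps:
  fixes f :: "real \<Rightarrow> real"
  shows "continuous (at_right a) f \<longleftrightarrow> (\<forall>e>0. \<exists>b>a. \<forall>y. a < y \<longrightarrow> y < b \<longrightarrow> \<bar>f y - f a\<bar> < e)"
  unfolding continuous_within tendsto_iff eventually_at_right_field dist_real_def by blast

section \<open>Distribution-function properties of the pointwise least cdf\<close>

context
  fixes \<mu> \<nu> :: "real measure"
  assumes \<mu>: "real_distribution \<mu>" and \<nu>: "real_distribution \<nu>" and st: "\<mu> \<preceq>\<^sub>s\<^sub>t \<nu>"
begin

interpretation \<mu>: real_distribution \<mu> by fact
interpretation \<nu>: real_distribution \<nu> by fact

abbreviation (input) inf_gap :: "real \<Rightarrow> real \<Rightarrow> real" where
  "inf_gap x y \<equiv> INF z\<in>{x..y}. gap \<mu> \<nu> z"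

lemma st_gap_nonneg: "0 \<le> gap \<mu> \<nu> z"
  using st by (simp add: st_le_def gap_def)

lemma inf_gap_le: "x \<le> z \<Longrightarrow> z \<le> y \<Longrightarrow> inf_gap x y \<le> gap \<mu> \<nu> z"
  using st_gap_nonneg by (intro cINF_lower bdd_belowI2[where m=0]) auto

lemma inf_gap_ge: "x \<le> y \<Longrightarrow> (\<And>z. x \<le> z \<Longrightarrow> z \<le> y \<Longrightarrow> c \<le> gap \<mu> \<nu> z) \<Longrightarrow> c \<le> inf_gap x y"
  by (intro cINF_greatest) auto

lemma inf_gap_antimono: "x \<le> x' \<Longrightarrow> x' \<le> y \<Longrightarrow> y \<le> y' \<Longrightarrow> inf_gap x y' \<le> inf_gap x' y"
  by (intro inf_gap_ge inf_gap_le) auto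

lemma inf_gap_split: "x \<le> x' \<Longrightarrow> x' \<le> y \<Longrightarrow> inf_gap x y = min (inf_gap x x') (inf_gap x' y)"
proof (rule antisym)
  assume *: "x \<le> x'" "x' \<le> y"
  show "inf_gap x y \<le> min (inf_gap x x') (inf_gap x' y)"
    using * by (simp add: inf_gap_antimono)
  show "min (inf_gap x x') (inf_gap x' y) \<le> inf_gap x y"
  proof (rule inf_gap_ge)
    fix z assume z: "x \<le> z" "z \<le> y"
    show "min (inf_gap x x') (inf_gap x' y) \<le> gap \<mu> \<nu> z"
      using inf_gap_le[of x z x'] inf_gap_le[of x' z y] z by (cases "z \<le> x'") auto
  qed (use * in auto)
qed

text \<open>Up to the constant \<open>cdf \<mu> x\<close>, this is monotonicity in \<open>y\<close> of the mass that the coupling to be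
  constructed gives to \<open>{x<..} \<times> {..y}\<close>.\<close>

lemma inf_gap_plus_mono:
  assumes "x \<le> y" "y \<le> y'"
  shows "inf_gap x y + cdf \<nu> y \<le> inf_gap x y' + cdf \<nu> y'"
proof -
  have "inf_gap x y + cdf \<nu> y - cdf \<nu> y' \<le> inf_gap x y'"
  proof (rule inf_gap_ge)
    fix z assume z: "x \<le> z" "z \<le> y'"
    show "inf_gap x y + cdf \<nu> y - cdf \<nu> y' \<le> gap \<mu> \<nu> z"
    proof (cases "z \<le> y")
      case True
      then show ?thesis using inf_gap_le[OF z(1) True] \<nu>.cdf_nondecreasing[OF assms(2)] by simp
    next
      case False
      then have "cdf \<mu> y \<le> cdf \<mu> z" "cdf \<nu> z \<le> cdf \<nu> y'" using z by (auto intro: \<mu>.cdf_nondecreasing \<nu>.cdf_nondecreasing)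
      then show ?thesis using inf_gap_le[OF assms(1) order_refl] by (simp add: gap_def)
    qed
  qed (use assms in auto)
  then show ?thesis by simp
qed

lemma least_cdf_mono:
  assumes "y \<le> y'"
  shows "least_cdf \<mu> \<nu> x y \<le> least_cdf \<mu> \<nu> x y'"
proof -
  consider "y' < x" | "y < x" "x \<le> y'" | "x \<le> y" by linarith
  then show ?thesis
  proof cases
    case 1
    then show ?thesis using assms by (auto simp: least_cdf_def intro: \<nu>.cdf_nondecreasing)
  next
    case 2
    then show ?thesis
      using inf_gap_le[of x x y'] \<nu>.cdf_nondecreasing[of y x] by (auto simp: least_cdf_def gap_def)
  next
    case 3
    then show ?thesis using assms inf_gap_antimono[of x x y y'] by (auto simp: least_cdf_def)
  qed
qed

text \<open>This makes the measure with cdf \<open>least_cdf \<mu> \<nu> x\<close> dominated by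
  \<nu>.\<close>

lemma least_cdf_snd_diff_mono:
  assumes "y \<le> y'"
  shows "cdf \<nu> y - least_cdf \<mu> \<nu> x y \<le> cdf \<nu> y' - least_cdf \<mu> \<nu> x y'"
proof -
  consider "y' < x" | "y < x" "x \<le> y'" | "x \<le> y" by linarith
  then show ?thesis
  proof cases
    case 1
    then show ?thesis using assms by (simp add: least_cdf_def)
  next
    case 2
    then show ?thesis
      using inf_gap_plus_mono[of x x y'] by (simp add: least_cdf_def gap_def)
  next
    case 3
    then show ?thesis using assms inf_gap_plus_mono[of x y y'] by (simp add: least_cdf_def)
  qed
qed

text \<open>Rectangles receive nonnegative mass. For \<open>x' \<le> y\<close>, write
  \<open>I\<close> for the infimum over \<open>[x', y]\<close> and \<open>c\<close> for that over
  \<open>[x, x']\<close>: the difference is a constant minus \<open>max (I - c) 0\<close>, and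
  \<open>I\<close> decreases in \<open>y\<close>.\<close>

lemma least_cdf_diff_mono:
  assumes "x \<le> x'" "y \<le> y'"
  shows "least_cdf \<mu> \<nu> x' y - least_cdf \<mu> \<nu> x y \<le> least_cdf \<mu> \<nu> x' y' - least_cdf \<mu> \<nu> x y'"
proof -
  have above: "least_cdf \<mu> \<nu> x' y - least_cdf \<mu> \<nu> x y \<le> least_cdf \<mu> \<nu> x' y' - least_cdf \<mu> \<nu> x y'"
    if "x' \<le> y" "y \<le> y'" for y y'
    using that assms(1) inf_gap_antimono[of x' x' y y'] inf_gap_split[of x x' y] inf_gap_split[of x x' y']
    by (auto simp: least_cdf_def)
  have at: "least_cdf \<mu> \<nu> x' y - least_cdf \<mu> \<nu> x y \<le> least_cdf \<mu> \<nu> x' x' - least_cdf \<mu> \<nu> x x'" if "y < x'" for y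
  proof -
    have "least_cdf \<mu> \<nu> x' y = cdf \<nu> y" "least_cdf \<mu> \<nu> x' x' = cdf \<nu> x'"
      using that by (auto simp: least_cdf_def gap_def)
    then show ?thesis using least_cdf_snd_diff_mono[of y x' x] that by simp
  qed
  consider "y' < x'" | "y < x'" "x' \<le> y'" | "x' \<le> y" by linarith
  then show ?thesis
  proof cases
    case 1
    then have "least_cdf \<mu> \<nu> x' y = cdf \<nu> y" "least_cdf \<mu> \<nu> x' y' = cdf \<nu> y'"
      using assms(2) by (auto simp: least_cdf_def)
    then show ?thesis using least_cdf_snd_diff_mono[OF assms(2), of x] by simp
  next
    case 2
    then show ?thesis using at[of y] above[of x' y'] by linarith
  next
    case 3
    then show ?thesis using above assms by blast
  qed
qed

lemma least_cdf_right_cont: "continuous (at_right a) (least_cdf \<mu> \<nu> x)"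
  unfolding continuous_at_right_iff_eps
proof (intro allI impI)
  fix e :: real assume "0 < e"
  have cont: "continuous (at_right a) (gap \<mu> \<nu>)"
    unfolding gap_def using \<mu>.cdf_is_right_cont \<nu>.cdf_is_right_cont by (intro continuous_diff)
  show "\<exists>b>a. \<forall>y. a < y \<longrightarrow> y < b \<longrightarrow> \<bar>least_cdf \<mu> \<nu> x y - least_cdf \<mu> \<nu> x a\<bar> < e"
  proof (cases "x \<le> a")
    case True
    obtain b where b: "b > a" "\<And>y. a < y \<Longrightarrow> y < b \<Longrightarrow> \<bar>gap \<mu> \<nu> y - gap \<mu> \<nu> a\<bar> < e / 2"
      using cont[unfolded continuous_at_right_iff_eps] \<open>0 < e\<close> by (meson half_gt_zero)
    have "\<bar>least_cdf \<mu> \<nu> x y - least_cdf \<mu> \<nu> x a\<bar> < e" if y: "a < y" "y < b" for y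
    proof -
      \<comment> \<open>Only the values of the gap on \<open>{a<..y}\<close> are new, and these are
        within \<open>e / 2\<close> of its value at \<open>a\<close>.\<close>
      have "inf_gap x a - e / 2 \<le> inf_gap x y"
      proof (rule inf_gap_ge)
        fix z assume z: "x \<le> z" "z \<le> y"
        show "inf_gap x a - e / 2 \<le> gap \<mu> \<nu> z"
          using inf_gap_le[of x z a] inf_gap_le[of x a a] b(2)[of z] z y True \<open>0 < e\<close>
          by (cases "z \<le> a") (auto simp: abs_if split: if_splits)
      qed (use True y in auto)
      moreover have "inf_gap x y \<le> inf_gap x a" using inf_gap_antimono[of x x a y] True y by simp
      ultimately show ?thesis using True y \<open>0 < e\<close> by (simp add: least_cdf_def)
    qed
    then show ?thesis using b(1) by blast
  next
    case False
    obtain b where b: "b > a" "\<And>y. a < y \<Longrightarrow> y < b \<Longrightarrow> \<bar>cdf \<nu> y - cdf \<nu> a\<bar> < e"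
      using \<nu>.cdf_is_right_cont[of a, unfolded continuous_at_right_iff_eps] \<open>0 < e\<close> by blast
    show ?thesis
      using False b by (intro exI[of _ "min b x"]) (auto simp: least_cdf_def)
  qed
qed

lemma least_cdf_at_bot: "(least_cdf \<mu> \<nu> x \<longlongrightarrow> 0) at_bot"
proof (rule Lim_transform_eventually[OF \<nu>.cdf_lim_at_bot])
  show "eventually (\<lambda>y. cdf \<nu> y = least_cdf \<mu> \<nu> x y) at_bot"
    using eventually_gt_at_bot eventually_at_bot_dense[of "\<lambda>y. y < x"]
    by (auto simp: least_cdf_def eventually_at_bot_dense intro!: exI[of _ x])
qed

text \<open>The gap vanishes at infinity and squeezes the infimum to 0. The limit fixes the total
  masses of the family, hence the first marginal.\<close>

lemma least_cdf_at_top: "(least_cdf \<mu> \<nu> x \<longlongrightarrow> cdf \<mu> x) at_top"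
proof -
  have lim: "(gap \<mu> \<nu> \<longlongrightarrow> 1 - 1) at_top"
    unfolding gap_def by (intro tendsto_diff \<mu>.cdf_lim_at_top_prob \<nu>.cdf_lim_at_top_prob)
  have "((\<lambda>y. inf_gap x y) \<longlongrightarrow> 0) at_top"
  proof (rule tendsto_sandwich[OF _ _ tendsto_const])
    show "eventually (\<lambda>y. 0 \<le> inf_gap x y) at_top"
      using eventually_ge_at_top[of x] by eventually_elim (intro inf_gap_ge st_gap_nonneg)
    show "eventually (\<lambda>y. inf_gap x y \<le> gap \<mu> \<nu> y) at_top"
      using eventually_ge_at_top[of x] by eventually_elim (intro inf_gap_le, auto)
  qed (use lim in simp)
  then have "((\<lambda>y. cdf \<mu> x - inf_gap x y) \<longlongrightarrow> cdf \<mu> x - 0) at_top" by (intro tendsto_intros)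
  then have "((\<lambda>y. cdf \<mu> x - inf_gap x y) \<longlongrightarrow> cdf \<mu> x) at_top" by simp
  then show ?thesis
    by (rule Lim_transform_eventually)
      (use eventually_ge_at_top[of x] in \<open>eventually_elim, simp add: least_cdf_def\<close>)
qed

lemma ex_coupling_least_cdf:
  obtains P where "P \<in> directional_couplings \<mu> \<nu>" "\<And>x y. cdf2 P x y = least_cdf \<mu> \<nu> x y"
proof -
  define M where "M x = interval_measure (least_cdf \<mu> \<nu> x)" for x
  have M_Iic: "emeasure (M x) {..y} = least_cdf \<mu> \<nu> x y" for x y
    unfolding M_def by (rule emeasure_interval_measure_Iic[OF least_cdf_mono least_cdf_right_cont least_cdf_at_bot])
  have M_UNIV: "emeasure (M x) UNIV = ennreal (cdf \<mu> x)" for x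
    unfolding M_def
    by (rule interval_measure_UNIV[OF least_cdf_mono least_cdf_right_cont least_cdf_at_bot least_cdf_at_top \<mu>.cdf_nonneg])
  have \<nu>_eq: "interval_measure (cdf \<nu>) = \<nu>"
    by (rule cdf_unique[OF real_distribution_interval_measure \<nu>])
      (auto intro: \<nu>.cdf_nondecreasing \<nu>.cdf_is_right_cont \<nu>.cdf_lim_at_bot \<nu>.cdf_lim_at_top_prob
        intro!: cdf_interval_measure)
  interpret U: prob_space uniform01 by (rule prob_space_uniform01)
  interpret W: pair_prob_space \<nu> uniform01 ..
  obtain f where f[measurable]: "f \<in> borel_measurable (borel \<Otimes>\<^sub>M borel)"
    and law: "\<And>x A. A \<in> sets borel \<Longrightarrow>
      emeasure (\<nu> \<Otimes>\<^sub>M uniform01) {p. f p \<le> x \<and> fst p \<in> A} = emeasure (M x) A"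
  proof (rule conditional_quantile[where \<mu>=\<mu> and N=\<nu> and M=M])
    show "emeasure (M x) A \<le> emeasure (M x') A" if "x \<le> x'" for x x' A
      unfolding M_def
      by (rule interval_measure_dominated[OF least_cdf_mono least_cdf_right_cont least_cdf_at_bot least_cdf_at_top
            least_cdf_diff_mono[OF that] least_cdf_right_cont least_cdf_at_bot least_cdf_at_top])
    show "emeasure (M x) A \<le> emeasure \<nu> A" for x A
      using interval_measure_dominated[OF least_cdf_mono least_cdf_right_cont least_cdf_at_bot least_cdf_at_top
            least_cdf_snd_diff_mono \<nu>.cdf_is_right_cont \<nu>.cdf_lim_at_bot \<nu>.cdf_lim_at_top_prob, of x A]
      unfolding M_def \<nu>_eq .
    show "measure (M x) UNIV = cdf \<mu> x" for x
      by (simp add: measure_def M_UNIV \<mu>.cdf_nonneg)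
  qed (use \<mu> \<nu> in \<open>auto simp: M_def\<close>)
  define P where "P = distr (\<nu> \<Otimes>\<^sub>M uniform01) borel (\<lambda>p. (f p, fst p))"
  have fm[measurable]: "(\<lambda>p. (f p, fst p)) \<in> \<nu> \<Otimes>\<^sub>M uniform01 \<rightarrow>\<^sub>M borel"
    unfolding borel_prod[symmetric] by measurable
  have P_law: "emeasure P ({..x} \<times> A) = emeasure (M x) A" if "A \<in> sets borel" for x A
  proof -
    have "{..x} \<times> A \<in> sets (borel :: (real \<times> real) measure)"
      using that unfolding borel_prod[symmetric] by auto
    then have "emeasure P ({..x} \<times> A) = emeasure (\<nu> \<Otimes>\<^sub>M uniform01) {p. f p \<le> x \<and> fst p \<in> A}"
      unfolding P_def
      by (subst emeasure_distr) (auto simp: space_pair_measure intro!: arg_cong[where f="emeasure (\<nu> \<Otimes>\<^sub>M uniform01)"])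
    then show ?thesis using law[OF that] by simp
  qed
  have prob: "prob_space P" unfolding P_def by (rule W.prob_space_distr[OF fm])
  interpret P: prob_space P by fact
  have sets_P: "sets P = sets borel" and space_P: "space P = UNIV" by (simp_all add: P_def)
  have rect: "A \<times> B \<in> sets P" if "A \<in> sets borel" "B \<in> sets borel" for A B
    using that by (simp add: sets_P borel_prod[symmetric])
  note fs[measurable] = measurable_fst_snd_borel[OF sets_P]
  have fst_P: "distr P borel fst = \<mu>"
  proof (rule cdf_unique[OF P.real_distribution_distr[OF fs(1)] \<mu>], rule ext)
    fix x
    have "cdf (distr P borel fst) x = measure P ({..x} \<times> UNIV)"
      unfolding cdf_def by (subst measure_distr) (auto simp: space_P intro!: arg_cong[where f="measure P"])
    then show "cdf (distr P borel fst) x = cdf \<mu> x"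
      by (simp add: measure_def P_law M_UNIV \<mu>.cdf_nonneg)
  qed
  have snd_P: "distr P borel snd = \<nu>"
  proof -
    have "distr P borel snd = distr (\<nu> \<Otimes>\<^sub>M uniform01) borel fst"
      unfolding P_def using measurable_fst_snd_borel[OF refl]
      by (subst distr_distr) (auto simp: comp_def)
    also have "\<dots> = distr (\<nu> \<Otimes>\<^sub>M uniform01) \<nu> fst" by (rule distr_cong) auto
    finally show ?thesis unfolding U.distr_pair_fst .
  qed
  have cdf2_P: "cdf2 P x y = least_cdf \<mu> \<nu> x y" for x y
  proof -
    have "0 \<le> least_cdf \<mu> \<nu> x y"
      by (rule mono_tendsto_0_nonneg[OF least_cdf_mono least_cdf_at_bot])
    then show ?thesis by (simp add: cdf2_def measure_def P_law M_Iic)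
  qed
  \<comment> \<open>The complement of \<open>halfplane\<close> is covered by these countably many
    rectangles, each null because \<open>least_cdf\<close> equals \<open>cdf \<nu>\<close> on the
    diagonal.\<close>
  have "AE p in P. p \<notin> {real_of_rat q<..} \<times> {..real_of_rat q}" for q
  proof -
    have "measure P (UNIV \<times> {..y}) = cdf \<nu> y" for y
      unfolding snd_P[symmetric] cdf_def
      by (subst measure_distr) (auto simp: space_P intro!: arg_cong[where f="measure P"])
    moreover have "measure P (UNIV \<times> {..y}) = cdf2 P y y + measure P ({y<..} \<times> {..y})" for y
      unfolding cdf2_def by (subst P.finite_measure_Union[symmetric])
        (auto intro!: rect arg_cong[where f="measure P"])
    ultimately have "measure P ({y<..} \<times> {..y}) = 0" for y
      by (simp add: cdf2_P least_cdf_def gap_def)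
    then show ?thesis using P.prob_eq_0[OF rect] by auto
  qed
  then have "AE p in P. \<forall>q. p \<notin> {real_of_rat q<..} \<times> {..real_of_rat q}" by (simp add: AE_all_countable)
  then have "AE p in P. p \<in> halfplane"
  proof eventually_elim
    case (elim p)
    show ?case
    proof (rule ccontr)
      assume "p \<notin> halfplane"
      then have "snd p < fst p" by (auto simp: halfplane_def)
      then obtain q where "snd p < of_rat q" "of_rat q < fst p" using of_rat_dense by blast
      then show False using elim by (cases p) (auto simp: less_imp_le dest: spec[of _ q])
    qed
  qed
  then have "measure P halfplane = 1" by (subst P.prob_eq_1) (auto simp: sets_P)
  then have "P \<in> directional_couplings \<mu> \<nu>"
    using prob sets_P fst_P snd_P by (simp add: directional_couplings_def)
  with cdf2_P show thesis using that by blast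
qed

end

section \<open>Minimal targets\<close>

lemma coupling_eqI_cdf2:
  assumes P: "P \<in> directional_couplings \<mu> \<nu>" and Q: "Q \<in> directional_couplings \<mu> \<nu>"
    and eq: "\<And>x y. cdf2 P x y = cdf2 Q x y"
  shows "P = Q"
proof (rule measure_eqI_quadrants)
  note PD = directional_couplingsD[OF P] and QD = directional_couplingsD[OF Q]
  interpret P: prob_space P by (rule PD(1))
  interpret Q: prob_space Q by (rule QD(1))
  show "finite_measure P" by (rule P.finite_measure_axioms)
  show "emeasure P ({..x} \<times> {..y}) = emeasure Q ({..x} \<times> {..y})" for x y
    using eq[of x y] by (simp add: cdf2_def P.emeasure_eq_measure Q.emeasure_eq_measure)
qed (use directional_couplingsD(2)[OF P] directional_couplingsD(2)[OF Q] in auto)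

lemma coupling_upper:
  assumes P: "P \<in> directional_couplings \<mu> \<nu>"
  shows "measure P ({x<..} \<times> {..y}) = cdf \<nu> y - cdf2 P x y"
proof -
  interpret P: prob_space P by (rule directional_couplingsD(1)[OF P])
  have "measure P (UNIV \<times> {..y}) = measure P ({..x} \<times> {..y}) + measure P ({x<..} \<times> {..y})"
    by (subst P.finite_measure_Union[symmetric])
      (auto intro!: rectangle_sets[OF P] arg_cong[where f="measure P"])
  then show ?thesis by (simp add: coupling_snd[OF P] cdf_def cdf2_def)
qed

text \<open>On \<open>halfplane\<close>, \<open>snd p \<le> t\<close> forces
  \<open>fst p \<le> t\<close>, which gives the stochastic order; domination by \<nu> only forgets
  the restriction on the first coordinate.\<close>

lemma slice_mem_target_candidates:
  assumes P: "P \<in> directional_couplings \<mu> \<nu>"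
  shows "slice P {x<..} \<in> target_candidates \<mu> \<nu> x"
proof -
  note PD = directional_couplingsD[OF P]
  interpret P: prob_space P by (rule PD(1))
  interpret \<mu>: real_distribution \<mu> by (rule coupling_real_distribution[OF P])
  interpret \<nu>: real_distribution \<nu> by (rule coupling_real_distribution[OF P])
  have slice: "emeasure (slice P {x<..}) A = ennreal (measure P ({x<..} \<times> A))" if "A \<in> sets borel" for A
    using emeasure_slice[OF PD(2) that] by (simp add: P.emeasure_eq_measure)
  have space_slice: "space (slice P {x<..}) = UNIV"
    using sets_eq_imp_space_eq[OF sets_slice] by simp
  have fin: "finite_borel_measure (slice P {x<..})"
    unfolding finite_borel_measure_def finite_borel_measure_axioms_def
    by (auto intro!: finite_measureI simp: space_slice slice)
  have dens: "measure (density \<mu> (indicator {x<..})) A = measure P (({x<..} \<inter> A) \<times> UNIV)"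
    if "A \<in> sets borel" for A
  proof -
    have "emeasure (density \<mu> (indicator {x<..})) A = emeasure \<mu> ({x<..} \<inter> A)"
      using that by (intro emeasure_restricted) auto
    moreover have "{x<..} \<inter> A \<in> sets borel" using that by auto
    ultimately show ?thesis by (simp add: measure_def[of "density _ _"] \<mu>.emeasure_eq_measure coupling_fst[OF P])
  qed
  have "density \<mu> (indicator {x<..}) \<preceq>\<^sub>s\<^sub>t slice P {x<..}"
    unfolding st_le_def
  proof (intro conjI allI)
    show "measure (density \<mu> (indicator {x<..})) UNIV = measure (slice P {x<..}) UNIV"
      by (simp add: dens measure_def[of "slice _ _"] slice)
    fix t
    have "measure P ({x<..} \<times> {..t}) \<le> measure P (({x<..} \<inter> {..t}) \<times> UNIV)"
    proof (rule P.finite_measure_mono_AE)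
      show "AE p in P. p \<in> {x<..} \<times> {..t} \<longrightarrow> p \<in> ({x<..} \<inter> {..t}) \<times> UNIV"
        using PD(6) by eventually_elim (auto simp: halfplane_def)
    qed (auto intro: rectangle_sets[OF P])
    then show "cdf (slice P {x<..}) t \<le> cdf (density \<mu> (indicator {x<..})) t"
      by (simp add: cdf_def dens measure_def[of "slice _ _"] slice)
  qed
  moreover have "slice P {x<..} \<le> \<nu>"
  proof -
    have "emeasure (slice P {x<..}) A \<le> emeasure \<nu> A" for A
    proof (cases "A \<in> sets borel")
      case True
      have "measure P ({x<..} \<times> A) \<le> measure P (UNIV \<times> A)"
        using True by (intro coupling_rectangle_mono[OF P]) auto
      then show ?thesis using True by (simp add: slice coupling_snd[OF P] \<nu>.emeasure_eq_measure)
    qed (simp add: emeasure_notin_sets)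
    then show ?thesis by (simp add: le_measure)
  qed
  ultimately show ?thesis using fin by (simp add: target_candidates_def)
qed

text \<open>For every \<open>z\<close> in \<open>[x, y]\<close>, the stochastic order bounds the
  mass of \<theta> up to \<open>z\<close> by the \<mu>-mass of \<open>{x<..z}\<close>, and
  domination bounds the rest by the \<nu>-mass of \<open>{z<..y}\<close>. The best \<open>z\<close>
  gives the infimum.\<close>

lemma target_candidate_cdf_le:
  assumes \<mu>: "real_distribution \<mu>" and \<nu>: "real_distribution \<nu>" and \<theta>: "\<theta> \<in> target_candidates \<mu> \<nu> x"
    and st: "\<mu> \<preceq>\<^sub>s\<^sub>t \<nu>"
  shows "cdf \<theta> y \<le> cdf \<nu> y - least_cdf \<mu> \<nu> x y"
proof -
  interpret \<mu>: real_distribution \<mu> by fact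
  interpret \<nu>: real_distribution \<nu> by fact
  interpret \<theta>: finite_borel_measure \<theta> using \<theta> by (simp add: target_candidates_def)
  have dens: "measure (density \<mu> (indicator {x<..})) A = measure \<mu> ({x<..} \<inter> A)" if "A \<in> sets borel" for A
    using emeasure_restricted[of "{x<..}" \<mu> A] that by (simp add: measure_def)
  have cdf_le: "cdf \<theta> z \<le> measure \<mu> ({x<..} \<inter> {..z})" for z
  proof -
    have "cdf \<theta> z \<le> cdf (density \<mu> (indicator {x<..})) z"
      using \<theta> by (simp add: target_candidates_def st_le_def)
    then show ?thesis using dens[of "{..z}"] by (simp add: cdf_def)
  qed
  have \<theta>_le: "emeasure \<theta> A \<le> emeasure \<nu> A" for A
    using \<theta> by (simp add: target_candidates_def le_measureD3 \<theta>.M_is_borel)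
  show ?thesis
  proof (cases "x \<le> y")
    case False
    then have "{x<..} \<inter> {..y} = {}" by auto
    then show ?thesis using cdf_le[of y] False by (simp add: least_cdf_def)
  next
    case True
    have "cdf \<theta> y - cdf \<nu> y + cdf \<mu> x \<le> (INF z\<in>{x..y}. gap \<mu> \<nu> z)"
    proof (rule cINF_greatest)
      fix z assume "z \<in> {x..y}"
      then have z: "x \<le> z" "z \<le> y" by auto
      have "{x<..} \<inter> {..z} = {x<..z}" by auto
      then have "cdf \<theta> z \<le> cdf \<mu> z - cdf \<mu> x"
        using cdf_le[of z] z(1) \<mu>.cdf_diff_eq[of x z] by (cases "x = z") auto
      moreover have "cdf \<theta> y - cdf \<theta> z \<le> cdf \<nu> y - cdf \<nu> z"
      proof (cases "z = y")
        case False
        then have "z < y" using z by simp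
        have "measure \<theta> {z<..y} \<le> measure \<nu> {z<..y}"
          using \<theta>_le[of "{z<..y}"] by (simp add: \<theta>.emeasure_eq_measure \<nu>.emeasure_eq_measure)
        then show ?thesis using \<theta>.cdf_diff_eq[OF \<open>z < y\<close>] \<nu>.cdf_diff_eq[OF \<open>z < y\<close>] by simp
      qed simp
      ultimately show "cdf \<theta> y - cdf \<nu> y + cdf \<mu> x \<le> gap \<mu> \<nu> z" by (simp add: gap_def)
    qed (use True in auto)
    then show ?thesis using True by (simp add: least_cdf_def)
  qed
qed

text \<open>The slice has the pointwise largest cdf among the candidates, so it is a least element
  and not just a minimal one; this makes the definite description meaningful.\<close>

lemma minimal_target_eq_slice:
  assumes st: "\<mu> \<preceq>\<^sub>s\<^sub>t \<nu>" and P: "P \<in> directional_couplings \<mu> \<nu>"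
    and least: "\<And>x y. cdf2 P x y = least_cdf \<mu> \<nu> x y"
  shows "minimal_target \<mu> \<nu> x = slice P {x<..}"
proof -
  note PD = directional_couplingsD[OF P] and mem = slice_mem_target_candidates[OF P, of x]
  interpret P: prob_space P by (rule PD(1))
  have cdf_slice: "cdf (slice P {x<..}) y = cdf \<nu> y - least_cdf \<mu> \<nu> x y" for y
    using coupling_upper[OF P, of x y] by (simp add: cdf_def measure_def[of "slice _ _"] emeasure_slice[OF PD(2)] least
      P.emeasure_eq_measure)
  have upper: "cdf \<theta> y \<le> cdf (slice P {x<..}) y" if "\<theta> \<in> target_candidates \<mu> \<nu> x" for \<theta> y
    unfolding cdf_slice using target_candidate_cdf_le[OF coupling_real_distribution[OF P] that st] .
  show ?thesis
    unfolding minimal_target_def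
  proof (rule the_equality, intro conjI ballI impI)
    fix \<theta> assume \<theta>: "\<theta> \<in> target_candidates \<mu> \<nu> x" "\<theta> \<preceq>\<^sub>s\<^sub>t slice P {x<..}"
    show "\<theta> = slice P {x<..}"
    proof (rule cdf_unique')
      show "finite_borel_measure \<theta>" "finite_borel_measure (slice P {x<..})"
        using \<theta>(1) mem by (simp_all add: target_candidates_def)
      show "cdf \<theta> = cdf (slice P {x<..})"
        using upper[OF \<theta>(1)] \<theta>(2) by (intro ext antisym) (auto simp: st_le_def)
    qed
  next
    fix \<theta> assume \<theta>: "\<theta> \<in> target_candidates \<mu> \<nu> x \<and> (\<forall>\<theta>'\<in>target_candidates \<mu> \<nu> x. \<theta>' \<preceq>\<^sub>s\<^sub>t \<theta> \<longrightarrow> \<theta>' = \<theta>)"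
    have "slice P {x<..} \<preceq>\<^sub>s\<^sub>t \<theta>"
      unfolding st_le_def
    proof (intro conjI allI)
      show "measure (slice P {x<..}) UNIV = measure \<theta> UNIV"
        using \<theta> mem by (simp add: target_candidates_def st_le_def)
      show "cdf \<theta> t \<le> cdf (slice P {x<..}) t" for t using \<theta> upper by blast
    qed
    with \<theta> mem show "\<theta> = slice P {x<..}" by blast
  qed (rule mem)
qed

text \<open>Uniqueness holds because the masses of \<open>{x<..} \<times> {..y}\<close> and the
  second marginal determine the cdf.\<close>

lemma optimal_directional_coupling_eqI:
  assumes st: "\<mu> \<preceq>\<^sub>s\<^sub>t \<nu>" and P: "P \<in> directional_couplings \<mu> \<nu>"
    and least: "\<And>x y. cdf2 P x y = least_cdf \<mu> \<nu> x y"
  shows "optimal_directional_coupling \<mu> \<nu> = P"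
  unfolding optimal_directional_coupling_def minimal_target_eq_slice[OF assms]
proof (rule the_equality, intro conjI ballI allI P)
  note PD = directional_couplingsD[OF P]
  show "emeasure P ({x<..} \<times> A) = emeasure (slice P {x<..}) A" if "A \<in> sets borel" for x A
    using emeasure_slice[OF PD(2) that] by simp
  fix P' assume P': "P' \<in> directional_couplings \<mu> \<nu> \<and>
    (\<forall>x. \<forall>A\<in>sets borel. emeasure P' ({x<..} \<times> A) = emeasure (slice P {x<..}) A)"
  show "P' = P"
  proof (rule coupling_eqI_cdf2[OF conjunct1[OF P'] P])
    fix x y
    have "emeasure P' ({x<..} \<times> {..y}) = emeasure P ({x<..} \<times> {..y})"
      using P' emeasure_slice[OF PD(2), of "{..y}" "{x<..}"] by simp
    then have "measure P' ({x<..} \<times> {..y}) = measure P ({x<..} \<times> {..y})" by (simp add: measure_def)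
    then show "cdf2 P' x y = cdf2 P x y"
      using coupling_upper[OF P, of x y] coupling_upper[OF conjunct1[OF P'], of x y] by simp
  qed
qed

section \<open>A strictly submodular reward and the equivalences\<close>

lemma ex_strictly_submodular:
  assumes "real_distribution \<mu>" "real_distribution \<nu>"
  obtains g where "marginal_integrable \<mu> \<nu> g" "strictly_submodular g"
proof
  interpret \<mu>: real_distribution \<mu> by fact
  interpret \<nu>: real_distribution \<nu> by fact
  \<comment> \<open>The product reward \<open>- x * y\<close> in bounded increasing coordinates:
    boundedness gives integrability for arbitrary marginals, and 4 is the square of the bound 2 on
    \<open>arctan\<close>.\<close>
  define g where "g p = - arctan (fst p) * arctan (snd p)" for p :: "real \<times> real"
  have bound: "\<bar>arctan t\<bar> \<le> 2" for t
    using arctan_bounded[of t] pi_less_4 by linarith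
  show "marginal_integrable \<mu> \<nu> g"
    unfolding marginal_integrable_def
  proof (intro exI conjI)
    show "\<forall>(x, y)\<in>halfplane. \<bar>g (x, y)\<bar> \<le> (\<lambda>_. 4) x + (\<lambda>_. 0) y"
      using mult_mono[OF bound bound] by (auto simp: g_def abs_mult)
  qed auto
  show "strictly_submodular g"
    unfolding strictly_submodular_def
  proof (intro conjI allI impI)
    have "continuous_on UNIV g"
      unfolding g_def[abs_def] by (intro continuous_intros)
    then show "g \<in> borel_measurable (restrict_space borel halfplane)"
      by (intro measurable_restrict_space1 borel_measurable_continuous_onI)
    fix x x' y y' :: real assume "x < x' \<and> x' \<le> y \<and> y < y'"
    then have "0 < (arctan x' - arctan x) * (arctan y' - arctan y)"
      by (intro mult_pos_pos) (auto simp: arctan_less_iff)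
    then show "g (x, y) + g (x', y') < g (x, y') + g (x', y)"
      by (simp add: g_def algebra_simps)
  qed
qed

lemma strictly_submodular_imp_submodular: "strictly_submodular g \<Longrightarrow> submodular g"
  unfolding strictly_submodular_def submodular_def by (meson less_imp_le)

theorem theorem2p2:
  fixes \<mu> \<nu> :: "real measure" and P :: "(real \<times> real) measure"
  assumes "real_distribution \<mu>" and "real_distribution \<nu>"
    and "\<mu> \<preceq>\<^sub>s\<^sub>t \<nu>"
    and "P \<in> directional_couplings \<mu> \<nu>"
  shows
    "((\<forall>Q \<in> directional_couplings \<mu> \<nu>. \<forall>x y. cdf2 P x y \<le> cdf2 Q x y)
        \<longleftrightarrow> P = optimal_directional_coupling \<mu> \<nu>) \<and>
     ((\<forall>g. marginal_integrable \<mu> \<nu> g \<and> submodular g \<longrightarrow> optimal_for \<mu> \<nu> g P)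
        \<longleftrightarrow> P = optimal_directional_coupling \<mu> \<nu>) \<and>
     ((\<exists>g. marginal_integrable \<mu> \<nu> g \<and> strictly_submodular g \<and> optimal_for \<mu> \<nu> g P)
        \<longleftrightarrow> P = optimal_directional_coupling \<mu> \<nu>) \<and>
     ((\<exists>\<Gamma>. \<Gamma> \<subseteq> halfplane \<and> constrained_crossing \<Gamma> \<and> supported_by P \<Gamma>)
        \<longleftrightarrow> P = optimal_directional_coupling \<mu> \<nu>)"
proof -
  note P = assms(4)
  obtain P\<^sub>0 where P\<^sub>0: "P\<^sub>0 \<in> directional_couplings \<mu> \<nu>" and least: "\<And>x y. cdf2 P\<^sub>0 x y = least_cdf \<mu> \<nu> x y"
    using ex_coupling_least_cdf[OF assms(1-3)] by blast
  have opt: "optimal_directional_coupling \<mu> \<nu> = P\<^sub>0"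
    by (rule optimal_directional_coupling_eqI[OF assms(3) P\<^sub>0 least])
  have eqI: "P = P\<^sub>0" if "\<And>x y. cdf2 P x y = least_cdf \<mu> \<nu> x y"
    by (rule coupling_eqI_cdf2[OF P P\<^sub>0]) (simp add: that least)
  obtain \<Gamma>\<^sub>0 where \<Gamma>\<^sub>0: "\<Gamma>\<^sub>0 \<subseteq> halfplane" "constrained_crossing \<Gamma>\<^sub>0" "supported_by P\<^sub>0 \<Gamma>\<^sub>0"
    using least_cdf_imp_noncrossing[OF P\<^sub>0 least] by blast
  have opt_sub: "optimal_for \<mu> \<nu> g P\<^sub>0" if "marginal_integrable \<mu> \<nu> g" "submodular g" for g
    unfolding optimal_for_iff using P\<^sub>0 noncrossing_optimal[OF P\<^sub>0 _ \<Gamma>\<^sub>0 that] by blast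
  have strict: "P = P\<^sub>0" if "marginal_integrable \<mu> \<nu> g" "strictly_submodular g" "optimal_for \<mu> \<nu> g P" for g
    by (intro eqI least_cdf_eqI[OF P] optimal_strictly_submodular_imp_AE_not_improvable[OF P that])
  \<comment> \<open>This reward is the witness for (iii), and also the instance of (ii) that forces
    the coupling to be \<open>P\<^sub>0\<close>.\<close>
  obtain g\<^sub>0 where g\<^sub>0: "marginal_integrable \<mu> \<nu> g\<^sub>0" "strictly_submodular g\<^sub>0"
    using ex_strictly_submodular[OF assms(1,2)] .
  note g\<^sub>0_sub = strictly_submodular_imp_submodular[OF g\<^sub>0(2)]
  show ?thesis
    unfolding opt
  proof (intro conjI iffI)
    assume "\<forall>Q \<in> directional_couplings \<mu> \<nu>. \<forall>x y. cdf2 P x y \<le> cdf2 Q x y"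
    \<comment> \<open>Comparison with \<open>P\<^sub>0\<close> bounds the cdf of \<open>P\<close>
      above by \<open>least_cdf\<close>; the reverse bound holds for every directional
      coupling.\<close>
    then show "P = P\<^sub>0"
      using P\<^sub>0 least least_cdf_le[OF P] by (intro eqI antisym) force+
  next
    assume "P = P\<^sub>0"
    then show "\<forall>Q \<in> directional_couplings \<mu> \<nu>. \<forall>x y. cdf2 P x y \<le> cdf2 Q x y"
      using least least_cdf_le by simp
  next
    assume "\<forall>g. marginal_integrable \<mu> \<nu> g \<and> submodular g \<longrightarrow> optimal_for \<mu> \<nu> g P"
    then show "P = P\<^sub>0" using strict[OF g\<^sub>0] g\<^sub>0(1) g\<^sub>0_sub by blast
  next
    assume "P = P\<^sub>0"
    then show "\<forall>g. marginal_integrable \<mu> \<nu> g \<and> submodular g \<longrightarrow> optimal_for \<mu> \<nu> g P"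
      using opt_sub by blast
  next
    assume "\<exists>g. marginal_integrable \<mu> \<nu> g \<and> strictly_submodular g \<and> optimal_for \<mu> \<nu> g P"
    then show "P = P\<^sub>0" using strict by blast
  next
    assume "P = P\<^sub>0"
    then show "\<exists>g. marginal_integrable \<mu> \<nu> g \<and> strictly_submodular g \<and> optimal_for \<mu> \<nu> g P"
      using g\<^sub>0 opt_sub[OF g\<^sub>0(1) g\<^sub>0_sub] by blast
  next
    assume "\<exists>\<Gamma>. \<Gamma> \<subseteq> halfplane \<and> constrained_crossing \<Gamma> \<and> supported_by P \<Gamma>"
    then show "P = P\<^sub>0"
      using least_cdf_eqI[OF P noncrossing_imp_AE_not_improvable[OF P]] by (auto intro: eqI)
  next
    assume "P = P\<^sub>0"
    then show "\<exists>\<Gamma>. \<Gamma> \<subseteq> halfplane \<and> constrained_crossing \<Gamma> \<and> supported_by P \<Gamma>"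
      using \<Gamma>\<^sub>0 by blast
  qed
qed


end
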